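(* Let $c\in[0,1]$. As $p+q\to\infty$ with $(p,q)\in\mathbf{N}$ such that $\frac{p}{p+q}\to c$, the random eigenvalues $\Lambda^*_{p,q}$ converge weakly (in distribution) to $\mathcal{T}$: $$\Lambda^*_{p,q}\xrightarrow[p+q\to\infty]{d}\mathcal{T}.$$
   Context: $\mathbb{N}_0=\{0,1,2,\ldots\}$ and $\mathbf{N}:=\{(p,q)\in\mathbb{N}_0^2 : p+q\ge 5,\ q\le p\}$. For such $(p,q)$, $\Lambda^*_{p,q}$ denotes the random eigenvalue of the dual infinite $(p,q)$-nanotube (the triangular lattice with a loop of weight $3$ at each vertex, rolled up along the chiral vector $(p,q)$), i.e. the real random variable with compactly supported distribution whose moments $\mu_k(\Lambda^*_{p,q})=\mathbb{E}(\Lambda^*_{p,q})^k$, $k\in\mathbb{N}_0$, are the (weighted) numbers of closed paths with $k$ steps from a vertex of this graph, given by $$\mu_k(\Lambda^*_{p,q})=\frac{1}{(2\pi)^3}\sum_{j\in\mathbb{Z}}\int_{-\pi}^{\pi}\int_{-\pi}^{\pi}\int_{-\pi}^{\pi}\left|e^{ix}+e^{iy}+e^{iz}\right|^{2k}e^{ij(p(x-z)+q(y-z))}\,dx\,dy\,dz .$$ For each fixed $k$ only finitely many terms of the sum are non-zero, and these moments determine the (compactly supported) distribution of $\Lambda^*_{p,q}$ uniquely. $\mathcal{T}$ denotes the random eigenvalue of the triangular lattice (with a loop of weight $3$ at each vertex). It is the compactly supported random variable with probability density function $$f_{\mathcal{T}}(x)=\frac12\int_0^\infty t\,J_0(t\sqrt{x})\,J_0^3(t)\,dt,\quad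 x>0,$$ where $J_0(x)=\sum_{k=0}^\infty\frac{(-1)^k}{(k!)^2}\left(\frac{x}{2}\right)^{2k}$ is the Bessel function of the first kind of order $0$. It is known from earlier work that its moments, which determine its distribution, are $$\mathbb{E}\,\mathcal{T}^k=\sum_{k_1+k_2+k_3=k}\binom{k}{k_1,k_2,k_3}^2,\quad k\in\mathbb{N}_0,$$ the sum being over non-negative integers $k_1,k_2,k_3$. *)

theory Defs
  imports "HOL-Probability.Probability"
begin

definition nanotube_indices :: "(nat \<times> nat) set" where
  "nanotube_indices = {(p, q). p + q \<ge> 5 \<and> q \<le> p}"

text \<open>
  The weighted number of closed walks of length \<open>k\<close> at a vertex of the dual infinite
  \<open>(p, q)\<close>-nanotube. The value is real; it is complex-typed only because of the integrand.
  For \<open>(p, q)\<close> in \<^const>\<open>nanotube_indices\<close>, only finitely many terms of the sum are nonzero.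
\<close>

definition nanotube_moment :: "nat \<Rightarrow> nat \<Rightarrow> nat \<Rightarrow> complex" where
  "nanotube_moment p q k =
     1 / (2 * of_real pi) ^ 3 *
     (\<Sum>\<^sub>\<infinity>j\<in>(UNIV :: int set).
        LBINT x:{-pi..pi}. LBINT y:{-pi..pi}. LBINT z:{-pi..pi}.
          of_real (norm (cis x + cis y + cis z) ^ (2 * k)) *
          cis (of_int j * (of_nat p * (x - z) + of_nat q * (y - z))))"

definition compactly_supported :: "'a measure \<Rightarrow> ('a \<Rightarrow> real) \<Rightarrow> bool" where
  "compactly_supported M X \<longleftrightarrow> (\<exists>K. compact K \<and> (AE \<omega> in M. X \<omega> \<in> K))"

text \<open>
  The moments determine a compactly supported law, so the following predicate fixes the
  law of \<open>X\<close> but not the underlying probability space.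
\<close>

definition nanotube_eigenvalue :: "nat \<Rightarrow> nat \<Rightarrow> 'a measure \<Rightarrow> ('a \<Rightarrow> real) \<Rightarrow> bool" where
  "nanotube_eigenvalue p q M X \<longleftrightarrow>
     prob_space M \<and> X \<in> borel_measurable M \<and> compactly_supported M X \<and>
     (\<forall>k. of_real (\<integral>\<omega>. X \<omega> ^ k \<partial>M) = nanotube_moment p q k)"

definition bessel_J0 :: "real \<Rightarrow> real" where
  "bessel_J0 x = (\<Sum>k. (-1) ^ k / (fact k)\<^sup>2 * (x / 2) ^ (2 * k))"

text \<open>
  The integrand decays only like \<open>1 / t\<close>, with oscillation, so the integral over
  \<open>(0, \<infinity>)\<close> is an improper one. It diverges at \<open>x = 1\<close>, where the value below is
  unspecified; this affects only a null set.
\<close>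

definition triangular_density :: "real \<Rightarrow> real" where
  "triangular_density x =
     (if x > 0
      then 1 / 2 * Lim at_top (\<lambda>R. LBINT t:{0..R}. t * bessel_J0 (t * sqrt x) * bessel_J0 t ^ 3)
      else 0)"

definition triangular_eigenvalue :: "'a measure \<Rightarrow> ('a \<Rightarrow> real) \<Rightarrow> bool" where
  "triangular_eigenvalue M X \<longleftrightarrow>
     prob_space M \<and> compactly_supported M X \<and>
     distributed M lborel X (\<lambda>x. ennreal (triangular_density x))"

end

theory Submission imports Defs begin

text \<open>
  Let \<open>V = |e\<^sup>i\<^sup>x + e\<^sup>i\<^sup>y + e\<^sup>i\<^sup>z|\<^sup>2\<close> for independent uniform angles. In the formula for the
  \<open>k\<close>-th moment of the nanotube the inner integral is a Fourier coefficient of frequency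
  \<open>j (p + q)\<close> of a trigonometric polynomial of degree \<open>k\<close>, so once \<open>p + q > k\<close> only \<open>j = 0\<close>
  survives and the moment equals \<open>E V\<^sup>k\<close>. Since \<open>V \<le> 9\<close>, Taylor expansion of characteristic
  functions and Levy's theorem reduce the claim to identifying the law of \<open>V\<close> with the law
  whose density is the Bessel integral.

  This is done by Laplace transforms: integrating \<open>exp (- l x)\<close> against the truncated Bessel
  integrals and against the law of \<open>V\<close> gives the same Gaussian integral of \<open>t J\<^sub>0(t)\<^sup>3\<close> in the
  limit, the latter because averaging \<open>J\<^sub>0(t |w + e\<^sup>i\<^sup>z|)\<close> over \<open>z\<close> gives \<open>J\<^sub>0(t |w|) J\<^sub>0(t)\<close>.
  The truncation is removed by dominated convergence; the domination comes from the
  asymptotics \<open>\<surd>t J\<^sub>0(t) = A cos t + B sin t + O(1/t)\<close>, in which the values of \<open>A\<close> and \<open>B\<close>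
  are irrelevant.
\<close>

subsection \<open>The Bessel function and its differential equation\<close>

text \<open>The integral over \<open>t\<close> converges only conditionally, its integrand being of
  size \<open>1 / t\<close>, so it cannot be exchanged directly with an integral over
  \<open>x\<close>. \<open>J0(t) ^ 3\<close> oscillates with frequencies 1 and 3, hence
  \<open>J0(t * s)\<close> with \<open>s = sqrt x\<close> is in resonance at \<open>x = 1\<close>
  and \<open>x = 9\<close>. Bounded antiderivatives would cost a factor \<open>1 / |s - 1|\<close>,
  which is not integrable; letting them grow like \<open>sqrt t\<close> lowers the cost to
  \<open>1 / sqrt |s - 1|\<close>, and the tails in \<open>t\<close> still tend to 0. The resulting
  bound does not decay in \<open>x\<close>, so the weight \<open>exp (- l x)\<close> supplies
  integrability. A second obstacle is the sign: \<open>ennreal\<close> replaces negative values of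
  the density by 0, and no nonnegativity of the Bessel integral is at hand. That the negative part
  vanishes almost everywhere is read off from the Laplace transforms themselves. Finally, the
  transforms are compared only for \<open>l > 0\<close>. Compact support makes both of them entire
  power series in \<open>l\<close>, which turns their equality into equality of moments, the form
  that the Taylor argument consumes.\<close>

definition bessel_coeff :: "nat \<Rightarrow> real" where
  "bessel_coeff k = (-1) ^ k / (fact k)\<^sup>2"

text \<open>In the variable \<open>y = t^2 / 4\<close> the Bessel function is an entire power
  series, so termwise differentiation through \<open>diffs\<close> is available everywhere.\<close>

definition bessel_series :: "real \<Rightarrow> real" where
  "bessel_series y = (\<Sum>k. bessel_coeff k * y ^ k)"

lemma bessel_J0_eq: "bessel_J0 t = bessel_series (t\<^sup>2 / 4)"
  by (simp add: bessel_J0_def bessel_series_def bessel_coeff_def power_mult power_divide)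

lemma abs_bessel_coeff_le: "\<bar>bessel_coeff k\<bar> \<le> 1 / fact k"
proof -
  have "(1::real) \<le> fact k" by (rule fact_ge_1)
  then have "(fact k :: real) \<le> (fact k)\<^sup>2" by (simp add: power2_eq_square)
  then show ?thesis by (auto simp: bessel_coeff_def power_abs abs_mult field_simps power2_eq_square)
qed

lemma summable_abs_bessel: "summable (\<lambda>k. \<bar>bessel_coeff k * y ^ k\<bar>)"
proof (rule summable_comparison_test'[OF summable_exp[of "\<bar>y\<bar>"]])
  show "norm \<bar>bessel_coeff k * y ^ k\<bar> \<le> inverse (fact k) * \<bar>y\<bar> ^ k" for k
    using mult_right_mono[OF abs_bessel_coeff_le[of k], of "\<bar>y\<bar> ^ k"]
    by (simp add: abs_mult power_abs divide_inverse)
qed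

lemma summable_bessel: "summable (\<lambda>k. bessel_coeff k * y ^ k)"
  using summable_abs_bessel by (rule summable_rabs_cancel)

definition bessel_series' :: "real \<Rightarrow> real" where
  "bessel_series' y = (\<Sum>k. diffs bessel_coeff k * y ^ k)"

definition bessel_series'' :: "real \<Rightarrow> real" where
  "bessel_series'' y = (\<Sum>k. diffs (diffs bessel_coeff) k * y ^ k)"

lemma DERIV_bessel_series: "(bessel_series has_real_derivative bessel_series' y) (at y)"
  unfolding bessel_series_def bessel_series'_def
  by (rule termdiffs_strong_converges_everywhere) (rule summable_bessel)

lemma DERIV_bessel_series': "(bessel_series' has_real_derivative bessel_series'' y) (at y)"
  unfolding bessel_series'_def bessel_series''_def
  by (rule termdiffs_strong_converges_everywhere, rule termdiff_converges_all, rule summable_bessel)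

text \<open>Comparison of coefficients: the claim reduces to
  \<open>(n + 1)^2 * bessel_coeff (n + 1) = - bessel_coeff n\<close>. It is Bessel's equation
  written in \<open>y = t^2 / 4\<close>.\<close>

lemma bessel_series_ode: "y * bessel_series'' y + bessel_series' y + bessel_series y = 0"
proof -
  have s1: "summable (\<lambda>n. diffs bessel_coeff n * y ^ n)" for y
    by (rule termdiff_converges_all, rule summable_bessel)
  have s2: "summable (\<lambda>n. diffs (diffs bessel_coeff) n * y ^ n)" for y
    by (rule termdiff_converges_all, rule s1)
  \<comment> \<open>At \<open>n = 0\<close> the exponent \<open>n - Suc 0\<close> is truncated to 0;
    the factor \<open>of_nat n\<close> makes both sides vanish there.\<close>
  have e1: "y * (of_nat n * diffs bessel_coeff n * y ^ (n - Suc 0)) = of_nat n * diffs bessel_coeff n * y ^ n" for n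
    by (cases n) (auto simp: algebra_simps)
  have "(\<lambda>n. y * (of_nat n * diffs bessel_coeff n * y ^ (n - Suc 0))) sums (y * bessel_series'' y)"
    unfolding bessel_series''_def by (intro sums_mult diffs_equiv s2)
  then have "(\<lambda>n. of_nat n * diffs bessel_coeff n * y ^ n) sums (y * bessel_series'' y)"
    by (simp only: e1)
  moreover have "(\<lambda>n. diffs bessel_coeff n * y ^ n) sums bessel_series' y"
    unfolding bessel_series'_def by (rule summable_sums[OF s1])
  moreover have "(\<lambda>n. bessel_coeff n * y ^ n) sums bessel_series y"
    unfolding bessel_series_def by (rule summable_sums[OF summable_bessel])
  ultimately have "(\<lambda>n. of_nat n * diffs bessel_coeff n * y ^ n + diffs bessel_coeff n * y ^ n
       + bessel_coeff n * y ^ n) sums (y * bessel_series'' y + bessel_series' y + bessel_series y)"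
    by (intro sums_add)
  moreover have "of_nat n * diffs bessel_coeff n * y ^ n + diffs bessel_coeff n * y ^ n
       + bessel_coeff n * y ^ n = 0" for n
  proof -
    have "of_nat n * diffs bessel_coeff n + diffs bessel_coeff n + bessel_coeff n = 0"
      unfolding diffs_def bessel_coeff_def fact_Suc
      by (simp add: field_simps power2_eq_square del: of_nat_Suc) (simp add: algebra_simps)
    then show ?thesis by (metis (no_types, lifting) distrib_right mult_zero_left)
  qed
  ultimately show ?thesis using sums_unique2[OF _ sums_zero] by simp
qed

definition bessel_J0' :: "real \<Rightarrow> real" where
  "bessel_J0' t = t / 2 * bessel_series' (t\<^sup>2 / 4)"

lemma DERIV_bessel_J0 [derivative_intros]:
  "(f has_real_derivative f') (at x within S) \<Longrightarrow>
     ((\<lambda>x. bessel_J0 (f x)) has_real_derivative bessel_J0' (f x) * f') (at x within S)"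
  unfolding bessel_J0_eq[abs_def] bessel_J0'_def
  by (rule DERIV_chain2[OF DERIV_bessel_series, THEN DERIV_cong])
     (auto intro!: derivative_eq_intros)

lemma DERIV_bessel_J0':
  assumes "t > 0"
  shows "(bessel_J0' has_real_derivative - bessel_J0 t - bessel_J0' t / t) (at t)"
proof -
  have "(bessel_J0' has_real_derivative 1 / 2 * bessel_series' (t\<^sup>2 / 4)
      + bessel_series'' (t\<^sup>2 / 4) * (t / 2) * (t / 2)) (at t)"
    unfolding bessel_J0'_def[abs_def]
    by (auto intro!: derivative_eq_intros DERIV_chain2[OF DERIV_bessel_series'])
  moreover have "1 / 2 * bessel_series' (t\<^sup>2 / 4) + bessel_series'' (t\<^sup>2 / 4) * (t / 2) * (t / 2)
      = - bessel_J0 t - bessel_J0' t / t"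
    using bessel_series_ode[of "t\<^sup>2 / 4"] assms
    by (simp add: bessel_J0_eq bessel_J0'_def field_simps power2_eq_square)
  ultimately show ?thesis by simp
qed

lemma continuous_on_bessel_J0 [continuous_intros]:
  "continuous_on S f \<Longrightarrow> continuous_on S (\<lambda>x. bessel_J0 (f x))"
  using continuous_on_compose2[of UNIV bessel_J0 S f] DERIV_bessel_J0[OF DERIV_ident]
  by (metis DERIV_isCont continuous_at_imp_continuous_on subset_UNIV)

lemma borel_measurable_bessel_J0 [measurable]: "bessel_J0 \<in> borel_measurable borel"
  by (intro borel_measurable_continuous_onI continuous_on_bessel_J0 continuous_on_id)

section \<open>Asymptotics of the Bessel function at infinity\<close>

text \<open>\<open>f + C / t\<close> decreases and \<open>f - C / t\<close> increases, and every
  value of the latter lies below every value of the former. Their common bound \<open>A\<close> is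
  the limit, with the rate \<open>C / t\<close> built in and no integration involved.\<close>

lemma limit_of_inverse_square_derivative:
  fixes f f' :: "real \<Rightarrow> real"
  assumes D: "\<And>t. t \<ge> 1 \<Longrightarrow> (f has_real_derivative f' t) (at t)"
    and bnd: "\<And>t. t \<ge> 1 \<Longrightarrow> \<bar>f' t\<bar> \<le> C / t\<^sup>2"
  shows "\<exists>A. \<forall>t\<ge>1. \<bar>f t - A\<bar> \<le> C / t"
proof -
  have C: "C \<ge> 0" using bnd[of 1] by auto
  have dec: "f t + C / t \<le> f s + C / s" if "1 \<le> s" "s \<le> t" for s t
  proof (rule DERIV_nonpos_imp_nonincreasing[OF \<open>s \<le> t\<close>])
    fix x assume x: "s \<le> x" "x \<le> t"
    have "((\<lambda>t. f t + C / t) has_real_derivative f' x - C / x\<^sup>2) (at x)"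
      using x that by (auto intro!: derivative_eq_intros D simp: power2_eq_square)
    moreover have "f' x - C / x\<^sup>2 \<le> 0" using bnd[of x] x that by auto
    ultimately show "\<exists>y. ((\<lambda>t. f t + C / t) has_real_derivative y) (at x) \<and> y \<le> 0" by blast
  qed
  have inc: "f s - C / s \<le> f t - C / t" if "1 \<le> s" "s \<le> t" for s t
  proof (rule DERIV_nonneg_imp_nondecreasing[OF \<open>s \<le> t\<close>])
    fix x assume x: "s \<le> x" "x \<le> t"
    have "((\<lambda>t. f t - C / t) has_real_derivative f' x + C / x\<^sup>2) (at x)"
      using x that by (auto intro!: derivative_eq_intros D simp: power2_eq_square)
    moreover have "0 \<le> f' x + C / x\<^sup>2" using bnd[of x] x that by auto
    ultimately show "\<exists>y. ((\<lambda>t. f t - C / t) has_real_derivative y) (at x) \<and> 0 \<le> y" by blast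
  qed
  have cross: "f s - C / s \<le> f t + C / t" if "1 \<le> s" "1 \<le> t" for s t
  proof -
    have "f s - C / s \<le> f (max s t) - C / max s t" using inc that by auto
    also have "\<dots> \<le> f (max s t) + C / max s t" using C that by (simp add: max_def)
    also have "\<dots> \<le> f t + C / t" using dec that by auto
    finally show ?thesis .
  qed
  define A where "A = (SUP s\<in>{1..}. f s - C / s)"
  have "\<bar>f t - A\<bar> \<le> C / t" if "t \<ge> 1" for t
  proof -
    have "f t - C / t \<le> A" unfolding A_def
      using cross that by (intro cSUP_upper bdd_aboveI2[where M = "f t + C / t"]) auto
    moreover have "A \<le> f t + C / t" unfolding A_def
      using cross that by (intro cSUP_least) auto
    ultimately show ?thesis by linarith
  qed
  then show ?thesis by blast
qed

text \<open>A Gronwall argument: the derivative of the factor \<open>exp (1 / t)\<close> compensates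
  the growth rate \<open>1 / t^2\<close>, and for \<open>t \<ge> 1\<close> that factor stays between
  1 and \<open>exp 1\<close>.\<close>

lemma bounded_of_inverse_square_growth:
  fixes M M' :: "real \<Rightarrow> real"
  assumes D: "\<And>t. t \<ge> 1 \<Longrightarrow> (M has_real_derivative M' t) (at t)"
    and bnd: "\<And>t. t \<ge> 1 \<Longrightarrow> M' t \<le> M t / t\<^sup>2"
    and "t \<ge> 1"
  shows "M t * exp (1 / t) \<le> M 1 * exp 1"
proof -
  have "M t * exp (1 / t) \<le> M 1 * exp (1 / 1)"
  proof (rule DERIV_nonpos_imp_nonincreasing[OF \<open>t \<ge> 1\<close>])
    fix x assume x: "1 \<le> x" "x \<le> t"
    have "((\<lambda>t. M t * exp (1 / t)) has_real_derivative (M' x - M x / x\<^sup>2) * exp (1 / x)) (at x)"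
      using x by (auto intro!: derivative_eq_intros D simp: power2_eq_square field_simps)
    moreover have "(M' x - M x / x\<^sup>2) * exp (1 / x) \<le> 0"
      using bnd[of x] x by (simp add: mult_nonpos_nonneg)
    ultimately show "\<exists>y. ((\<lambda>t. M t * exp (1 / t)) has_real_derivative y) (at x) \<and> y \<le> 0" by blast
  qed
  then show ?thesis by simp
qed

text \<open>The function \<open>u = sqrt t * J0(t)\<close> solves
  \<open>u'' = - u - u / (4 * t^2)\<close>, a harmonic oscillator with an integrable perturbation.
  Its energy \<open>u^2 + u'^2\<close> therefore stays bounded, and the bound on \<open>u\<close>
  then controls the drift of amplitude and phase.\<close>

lemma bessel_J0_asymptotics:
  obtains A B C where
    "\<And>t. t > 0 \<Longrightarrow> \<bar>sqrt t * bessel_J0 t - (A * cos t + B * sin t)\<bar> \<le> C / t"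
    "\<And>t. t \<ge> 0 \<Longrightarrow> \<bar>bessel_J0 t\<bar> \<le> C"
    "\<And>t. t \<ge> 0 \<Longrightarrow> \<bar>sqrt t * bessel_J0 t\<bar> \<le> C"
proof -
  define u where "u t = sqrt t * bessel_J0 t" for t
  define u' where "u' t = sqrt t * bessel_J0' t + bessel_J0 t / (2 * sqrt t)" for t
  have Du: "(u has_real_derivative u' t) (at t)" if "t > 0" for t
    unfolding u_def[abs_def] u'_def using that
    by (auto intro!: derivative_eq_intros simp: field_simps)
  have Du': "(u' has_real_derivative - u t - u t / (4 * t\<^sup>2)) (at t)" if t: "t > 0" for t
  proof -
    \<comment> \<open>With \<open>t = r^2\<close> the identity to be checked becomes rational in
      \<open>r\<close>.\<close>
    define r where "r = sqrt t"
    have r: "r > 0" "t = r\<^sup>2" using t by (auto simp: r_def)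
    have "(u' has_real_derivative
       (sqrt t * (- bessel_J0 t - bessel_J0' t / t) + inverse (sqrt t) / 2 * bessel_J0' t)
       + (bessel_J0' t * (2 * sqrt t) - bessel_J0 t * (2 * (inverse (sqrt t) / 2))) / (2 * sqrt t)\<^sup>2) (at t)"
      unfolding u'_def[abs_def] using t
      by (auto intro!: derivative_eq_intros DERIV_bessel_J0' simp: power2_eq_square)
    moreover have "(sqrt t * (- bessel_J0 t - bessel_J0' t / t) + inverse (sqrt t) / 2 * bessel_J0' t)
       + (bessel_J0' t * (2 * sqrt t) - bessel_J0 t * (2 * (inverse (sqrt t) / 2))) / (2 * sqrt t)\<^sup>2
       = - u t - u t / (4 * t\<^sup>2)"
      unfolding u_def r_def[symmetric] r(2) using r(1)
      by (simp add: field_simps power2_eq_square)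
    ultimately show ?thesis by simp
  qed
  have "\<exists>C. \<forall>t\<ge>1. \<bar>u t\<bar> \<le> C"
  proof -
    define E where "E t = (u t)\<^sup>2 + (u' t)\<^sup>2" for t
    have DE: "(E has_real_derivative - u t * u' t / (2 * t\<^sup>2)) (at t)" if "t \<ge> 1" for t
      unfolding E_def[abs_def] using that
      by (auto intro!: derivative_eq_intros Du Du' simp: field_simps)
    have "- u t * u' t / (2 * t\<^sup>2) \<le> E t / t\<^sup>2" if "t \<ge> 1" for t
    proof -
      \<comment> \<open>The right-hand side is \<open>4 * E t + 2 * u t * u' t\<close>, so division
        by 4 bounds the numerator of the derivative of \<open>E\<close>.\<close>
      have "0 \<le> (u t + u' t)\<^sup>2 + 3 * (u t)\<^sup>2 + 3 * (u' t)\<^sup>2" by simp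
      then have "- u t * u' t / 2 \<le> E t"
        by (simp add: E_def power2_eq_square algebra_simps)
      then have "- u t * u' t / 2 / t\<^sup>2 \<le> E t / t\<^sup>2" by (rule divide_right_mono) simp
      then show ?thesis by simp
    qed
    note EE = bounded_of_inverse_square_growth[OF DE this]
    have "\<bar>u t\<bar> \<le> sqrt (E 1 * exp 1)" if "t \<ge> 1" for t
    proof -
      have "(u t)\<^sup>2 \<le> E t" by (simp add: E_def)
      also have "E t \<le> E t * exp (1 / t)"
        using that mult_left_mono[of 1 "exp (1 / t)" "E t"] by (simp add: E_def)
      also have "\<dots> \<le> E 1 * exp 1" using EE that by auto
      finally show ?thesis by (simp add: real_le_rsqrt flip: real_sqrt_abs)
    qed
    then show ?thesis by blast
  qed
  then obtain C1 where C1: "\<And>t. t \<ge> 1 \<Longrightarrow> \<bar>u t\<bar> \<le> C1" by blast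
  have "C1 \<ge> 0" using C1[of 1] by auto
  have aux: "\<bar>w / (4 * t\<^sup>2)\<bar> \<le> C1 / t\<^sup>2" if "\<bar>w\<bar> \<le> C1" for w t :: real
  proof -
    have "\<bar>w / (4 * t\<^sup>2)\<bar> = \<bar>w\<bar> / 4 / t\<^sup>2" by (simp add: abs_mult)
    also have "\<dots> \<le> C1 / t\<^sup>2" using that by (intro divide_right_mono) auto
    finally show ?thesis .
  qed
  have trig: "\<bar>x * y\<bar> \<le> C1" if "\<bar>x\<bar> \<le> C1" "\<bar>y\<bar> \<le> 1" for x y :: real
    using mult_mono[OF that] \<open>C1 \<ge> 0\<close> by (simp add: abs_mult)
  \<comment> \<open>Variation of constants: \<open>u = a cos + b sin\<close> with slowly varying \<open>a\<close> and \<open>b\<close>.\<close>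
  define a where "a t = u t * cos t - u' t * sin t" for t
  define b where "b t = u t * sin t + u' t * cos t" for t
  have "\<exists>A. \<forall>t\<ge>1. \<bar>a t - A\<bar> \<le> C1 / t"
  proof (rule limit_of_inverse_square_derivative)
    fix t :: real assume t: "t \<ge> 1"
    show "(a has_real_derivative (u t * sin t) / (4 * t\<^sup>2)) (at t)"
      unfolding a_def[abs_def] using t
      by (auto intro!: derivative_eq_intros Du Du' simp: algebra_simps)
    show "\<bar>(u t * sin t) / (4 * t\<^sup>2)\<bar> \<le> C1 / t\<^sup>2"
      by (rule aux, rule trig) (use C1 t in auto)
  qed
  then obtain A where A: "\<And>t. t \<ge> 1 \<Longrightarrow> \<bar>a t - A\<bar> \<le> C1 / t" by blast
  have "\<exists>A. \<forall>t\<ge>1. \<bar>b t - A\<bar> \<le> C1 / t"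
  proof (rule limit_of_inverse_square_derivative)
    fix t :: real assume t: "t \<ge> 1"
    show "(b has_real_derivative (u t * (- cos t)) / (4 * t\<^sup>2)) (at t)"
      unfolding b_def[abs_def] using t
      by (auto intro!: derivative_eq_intros Du Du' simp: algebra_simps)
    show "\<bar>(u t * (- cos t)) / (4 * t\<^sup>2)\<bar> \<le> C1 / t\<^sup>2"
      by (rule aux, rule trig) (use C1 t in auto)
  qed
  then obtain B where B: "\<And>t. t \<ge> 1 \<Longrightarrow> \<bar>b t - B\<bar> \<le> C1 / t" by blast
  have u_ab: "u t = a t * cos t + b t * sin t" for t
  proof -
    have "a t * cos t + b t * sin t = u t * ((sin t)\<^sup>2 + (cos t)\<^sup>2)"
      unfolding a_def b_def power2_eq_square by (simp only: algebra_simps)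
    also have "\<dots> = u t" by (simp only: sin_cos_squared_add mult_1_right)
    finally show ?thesis by (rule sym)
  qed
  have asym1: "\<bar>u t - (A * cos t + B * sin t)\<bar> \<le> 2 * C1 / t" if "t \<ge> 1" for t
  proof -
    have "u t - (A * cos t + B * sin t) = (a t - A) * cos t + (b t - B) * sin t"
      unfolding u_ab[of t] by (simp add: algebra_simps)
    also have "\<bar>\<dots>\<bar> \<le> \<bar>a t - A\<bar> * \<bar>cos t\<bar> + \<bar>b t - B\<bar> * \<bar>sin t\<bar>"
      by (metis abs_mult abs_triangle_ineq)
    also have "\<dots> \<le> \<bar>a t - A\<bar> + \<bar>b t - B\<bar>"
      by (intro add_mono mult_left_le) auto
    finally show ?thesis using A[OF that] B[OF that] by simp
  qed
  obtain C2 where C2: "\<And>t. t \<in> {0..1} \<Longrightarrow> \<bar>bessel_J0 t\<bar> \<le> C2"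
  proof -
    have "compact (bessel_J0 ` {0..1})"
      by (intro compact_continuous_image continuous_on_bessel_J0 continuous_on_id) auto
    then have "bounded (bessel_J0 ` {0..1})" by (rule compact_imp_bounded)
    then show ?thesis using that unfolding bounded_iff by (metis image_eqI real_norm_def)
  qed
  have "C2 \<ge> 0" using C2[of 0] by auto
  have u01: "\<bar>u t\<bar> \<le> C2" if "t \<in> {0..1}" for t
  proof -
    have "sqrt t * \<bar>bessel_J0 t\<bar> \<le> 1 * C2" using C2[OF that] that by (intro mult_mono) auto
    then show ?thesis using that by (simp add: u_def abs_mult)
  qed
  \<comment> \<open>One constant serves all three bounds: \<open>2 * C1\<close> covers
    \<open>t \<ge> 1\<close>, and the other summands cover \<open>t < 1\<close>, where
    \<open>C \<le> C / t\<close>.\<close>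
  define C where "C = 2 * C1 + C2 + \<bar>A\<bar> + \<bar>B\<bar>"
  show thesis
  proof (rule that[of A B C])
    fix t :: real assume t: "t > 0"
    show "\<bar>sqrt t * bessel_J0 t - (A * cos t + B * sin t)\<bar> \<le> C / t"
    proof (cases "t \<ge> 1")
      case True
      have "2 * C1 / t \<le> C / t" using t \<open>C2 \<ge> 0\<close> by (intro divide_right_mono) (auto simp: C_def)
      then show ?thesis using asym1[OF True] by (simp add: u_def)
    next
      case False
      have "\<bar>A * cos t\<bar> \<le> \<bar>A\<bar>" "\<bar>B * sin t\<bar> \<le> \<bar>B\<bar>"
        by (auto simp: abs_mult intro!: mult_left_le)
      then have "\<bar>u t - (A * cos t + B * sin t)\<bar> \<le> C"
        using u01[of t] t False \<open>C1 \<ge> 0\<close> by (simp add: C_def)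
      also have "C \<le> C / t" using t False \<open>C1 \<ge> 0\<close> \<open>C2 \<ge> 0\<close>
        by (simp add: C_def pos_le_divide_eq mult_left_le)
      finally show ?thesis by (simp add: u_def)
    qed
  next
    fix t :: real assume t: "t \<ge> 0"
    have u: "\<bar>u t\<bar> \<le> C1 + C2"
      using C1[of t] u01[of t] t \<open>C1 \<ge> 0\<close> \<open>C2 \<ge> 0\<close> by (cases "t \<ge> 1") auto
    then show "\<bar>sqrt t * bessel_J0 t\<bar> \<le> C" using \<open>C1 \<ge> 0\<close> by (simp add: C_def u_def)
    show "\<bar>bessel_J0 t\<bar> \<le> C"
    proof (cases "t \<ge> 1")
      case True
      have "\<bar>bessel_J0 t\<bar> \<le> sqrt t * \<bar>bessel_J0 t\<bar>" using True by (simp add: mult_le_cancel_right1)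
      also have "\<dots> = \<bar>u t\<bar>" using t by (simp add: u_def abs_mult)
      finally show ?thesis using u \<open>C1 \<ge> 0\<close> by (simp add: C_def)
    qed (use t C2[of t] \<open>C1 \<ge> 0\<close> in \<open>auto simp: C_def\<close>)
  qed
qed

subsection \<open>Oscillatory integrals\<close>

text \<open>Integration by parts: \<open>\<psi> / t\<close> is the derivative of
  \<open>\<Psi> / t\<close> plus \<open>\<Psi> / t^2\<close>. If \<open>\<Psi>\<close> grows no
  faster than \<open>sqrt t\<close>, the boundary terms and the integral of
  \<open>M * t powr (-3/2)\<close> are all of order \<open>M / sqrt a\<close>.\<close>

lemma sqrt_antiderivative_integral_bound:
  fixes \<psi> \<Psi> :: "real \<Rightarrow> real"
  assumes D: "\<And>t. t > 0 \<Longrightarrow> (\<Psi> has_real_derivative \<psi> t) (at t)"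
    and bnd: "\<And>t. t > 0 \<Longrightarrow> \<bar>\<Psi> t\<bar> \<le> M * sqrt t"
    and cont: "continuous_on {a..R} \<psi>" and a: "0 < a" "a \<le> R"
  shows "\<bar>integral {a..R} (\<lambda>t. \<psi> t / t)\<bar> \<le> 4 * M / sqrt a"
proof -
  have M: "M \<ge> 0" using bnd[of 1] by auto
  have contP: "continuous_on {a..R} \<Psi>"
    using D a by (intro DERIV_continuous_on[where D = \<psi>]) (auto intro: has_field_derivative_at_within)
  have 1: "((\<lambda>t. \<psi> t / t - \<Psi> t / t\<^sup>2) has_integral (\<Psi> R / R - \<Psi> a / a)) {a..R}"
  proof (rule fundamental_theorem_of_calculus[OF a(2)])
    fix x assume "x \<in> {a..R}"
    then have x: "x > 0" using a by auto
    have "((\<lambda>t. \<Psi> t / t) has_real_derivative \<psi> x / x - \<Psi> x / x\<^sup>2) (at x)"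
      using x by (auto intro!: derivative_eq_intros D simp: field_simps power2_eq_square)
    then show "((\<lambda>t. \<Psi> t / t) has_vector_derivative \<psi> x / x - \<Psi> x / x\<^sup>2) (at x within {a..R})"
      by (simp add: has_real_derivative_iff_has_vector_derivative has_vector_derivative_at_within)
  qed
  have 2: "((\<lambda>t. M / (t * sqrt t)) has_integral (- 2 * M / sqrt R - - 2 * M / sqrt a)) {a..R}"
  proof (rule fundamental_theorem_of_calculus[OF a(2)])
    fix x assume "x \<in> {a..R}"
    then have x: "x > 0" using a by auto
    have "((\<lambda>t. - 2 * M / sqrt t) has_real_derivative M / (x * sqrt x)) (at x)"
      using x by (auto intro!: derivative_eq_intros simp: field_simps power2_eq_square)
    then show "((\<lambda>t. - 2 * M / sqrt t) has_vector_derivative M / (x * sqrt x)) (at x within {a..R})"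
      by (simp add: has_real_derivative_iff_has_vector_derivative has_vector_derivative_at_within)
  qed
  have i1: "(\<lambda>t. \<psi> t / t) integrable_on {a..R}" and i2: "(\<lambda>t. \<Psi> t / t\<^sup>2) integrable_on {a..R}"
    using a by (auto intro!: integrable_continuous_real continuous_intros cont contP)
  have "integral {a..R} (\<lambda>t. \<psi> t / t) = \<Psi> R / R - \<Psi> a / a + integral {a..R} (\<lambda>t. \<Psi> t / t\<^sup>2)"
    using integral_unique[OF 1] integral_diff[OF i1 i2] by simp
  moreover have "\<bar>integral {a..R} (\<lambda>t. \<Psi> t / t\<^sup>2)\<bar> \<le> - 2 * M / sqrt R - - 2 * M / sqrt a"
    unfolding integral_unique[OF 2, symmetric] real_norm_def[symmetric]
  proof (rule integral_norm_bound_integral[OF i2])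
    fix x assume "x \<in> {a..R}"
    then have x: "x > 0" using a by auto
    have "\<bar>\<Psi> x\<bar> / x\<^sup>2 \<le> M * sqrt x / x\<^sup>2" using bnd[OF x] by (rule divide_right_mono) simp
    also have "\<dots> = M / (x * sqrt x)" using x by (simp add: field_simps power2_eq_square)
    finally show "norm (\<Psi> x / x\<^sup>2) \<le> M / (x * sqrt x)" by simp
  qed (use 2 in blast)
  moreover have PP: "\<bar>\<Psi> t / t\<bar> \<le> M / sqrt t" if "t > 0" for t
  proof -
    have "\<bar>\<Psi> t\<bar> / t \<le> M * sqrt t / t" using bnd[OF that] that by (intro divide_right_mono) auto
    also have "\<dots> = M / sqrt t" using that by (simp add: field_simps)
    finally show ?thesis using that by simp
  qed
  have "\<bar>\<Psi> R / R\<bar> \<le> M / sqrt R" "\<bar>\<Psi> a / a\<bar> \<le> M / sqrt a" using PP a by auto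
  moreover have "M / sqrt R \<le> M / sqrt a" "0 \<le> M / sqrt R" using a M by (auto intro!: divide_left_mono)
  ultimately show ?thesis by linarith
qed

text \<open>Growth like \<open>sqrt t\<close> is a compromise. An antiderivative of a wave of
  frequency \<open>\<omega>\<close> is bounded both by \<open>2 / |\<omega>|\<close> and by
  \<open>t\<close>; the geometric mean of these bounds grows with \<open>t\<close> but has only the
  integrable singularity \<open>1 / sqrt |\<omega>|\<close> at resonance.\<close>

definition slow_antiderivative :: "real \<Rightarrow> (real \<Rightarrow> real) \<Rightarrow> bool" where
  "slow_antiderivative M \<psi> \<longleftrightarrow>
     (\<exists>\<Psi>. \<forall>t>0. (\<Psi> has_real_derivative \<psi> t) (at t) \<and> \<bar>\<Psi> t\<bar> \<le> M * sqrt t)"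

lemma slow_antiderivative_add:
  assumes "slow_antiderivative M f" "slow_antiderivative N g"
  shows "slow_antiderivative (M + N) (\<lambda>t. f t + g t)"
proof -
  obtain F G where "\<forall>t>0. (F has_real_derivative f t) (at t) \<and> \<bar>F t\<bar> \<le> M * sqrt t"
      "\<forall>t>0. (G has_real_derivative g t) (at t) \<and> \<bar>G t\<bar> \<le> N * sqrt t"
    using assms unfolding slow_antiderivative_def by blast
  then show ?thesis unfolding slow_antiderivative_def
    by (intro exI[of _ "\<lambda>t. F t + G t"])
       (auto intro!: derivative_intros order_trans[OF abs_triangle_ineq] add_mono simp: distrib_right)
qed

lemma slow_antiderivative_cmult:
  assumes "slow_antiderivative M f"
  shows "slow_antiderivative (\<bar>c\<bar> * M) (\<lambda>t. c * f t)"
proof -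
  obtain F where "\<forall>t>0. (F has_real_derivative f t) (at t) \<and> \<bar>F t\<bar> \<le> M * sqrt t"
    using assms unfolding slow_antiderivative_def by blast
  then show ?thesis unfolding slow_antiderivative_def
    by (intro exI[of _ "\<lambda>t. c * F t"])
       (auto intro!: DERIV_cmult mult_left_mono simp: abs_mult mult.assoc)
qed

lemma min_le_sqrt: "min 2 \<bar>x\<bar> \<le> 2 * sqrt \<bar>x\<bar>"
proof (cases "\<bar>x\<bar> \<le> 1")
  case True
  have "\<bar>x\<bar> = sqrt \<bar>x\<bar> * sqrt \<bar>x\<bar>" by simp
  also have "\<dots> \<le> sqrt \<bar>x\<bar> * 1" using True by (intro mult_left_mono) auto
  finally have "\<bar>x\<bar> \<le> sqrt \<bar>x\<bar>" by simp
  moreover have "0 \<le> sqrt \<bar>x\<bar>" by simp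
  ultimately show ?thesis by linarith
next
  case False
  then show ?thesis by (simp add: min_def) (smt (verit) real_sqrt_ge_1_iff)
qed

lemma slow_antiderivative_trig:
  assumes "\<omega> \<noteq> 0"
  shows "slow_antiderivative (2 / sqrt \<bar>\<omega>\<bar>) (\<lambda>t. cos (\<omega> * t))"
    and "slow_antiderivative (2 / sqrt \<bar>\<omega>\<bar>) (\<lambda>t. sin (\<omega> * t))"
proof -
  have bound: "\<bar>w / \<omega>\<bar> \<le> 2 / sqrt \<bar>\<omega>\<bar> * sqrt t" if "\<bar>w\<bar> \<le> min 2 \<bar>\<omega> * t\<bar>" "t > 0" for w t
  proof -
    have "\<bar>w\<bar> \<le> 2 * sqrt \<bar>\<omega> * t\<bar>" using that(1) min_le_sqrt order_trans by blast
    also have "\<dots> = (2 / sqrt \<bar>\<omega>\<bar> * sqrt t) * (sqrt \<bar>\<omega>\<bar> * sqrt \<bar>\<omega>\<bar>)"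
      using assms that by (simp add: abs_mult real_sqrt_mult del: real_sqrt_mult_self)
    finally show ?thesis using assms by (simp add: pos_divide_le_eq)
  qed
  have "\<forall>t>0. ((\<lambda>t. sin (\<omega> * t) / \<omega>) has_real_derivative cos (\<omega> * t)) (at t) \<and>
      \<bar>sin (\<omega> * t) / \<omega>\<bar> \<le> 2 / sqrt \<bar>\<omega>\<bar> * sqrt t"
    using assms abs_sin_le_one
    by (intro allI impI conjI bound) (auto intro!: derivative_eq_intros abs_sin_x_le_abs_x order_trans[OF abs_sin_le_one] simp: min_def)
  then show "slow_antiderivative (2 / sqrt \<bar>\<omega>\<bar>) (\<lambda>t. cos (\<omega> * t))"
    unfolding slow_antiderivative_def by blast
  \<comment> \<open>The antiderivative of the sine is normalised to vanish at 0, so that it also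
    obeys the linear bound near 0.\<close>
  have cos1: "\<bar>1 - cos x\<bar> \<le> min 2 \<bar>x\<bar>" for x :: real
  proof -
    have "1 - cos x = 2 * (sin (x / 2))\<^sup>2" using cos_double_sin[of "x / 2"] by simp
    also have "\<dots> = 2 * \<bar>sin (x / 2)\<bar> * \<bar>sin (x / 2)\<bar>" by (simp add: power2_eq_square abs_mult_self_eq)
    also have "\<dots> \<le> 2 * \<bar>x / 2\<bar> * 1" by (intro mult_mono mult_left_mono abs_sin_x_le_abs_x) auto
    finally show ?thesis using cos_ge_minus_one[of x] cos_le_one[of x] by (simp add: min_def)
  qed
  have "\<forall>t>0. ((\<lambda>t. (1 - cos (\<omega> * t)) / \<omega>) has_real_derivative sin (\<omega> * t)) (at t) \<and>
      \<bar>(1 - cos (\<omega> * t)) / \<omega>\<bar> \<le> 2 / sqrt \<bar>\<omega>\<bar> * sqrt t"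
    using assms by (intro allI impI conjI bound cos1) (auto intro!: derivative_eq_intros)
  then show "slow_antiderivative (2 / sqrt \<bar>\<omega>\<bar>) (\<lambda>t. sin (\<omega> * t))"
    unfolding slow_antiderivative_def by blast
qed

lemma slow_antiderivative_mono:
  "slow_antiderivative M f \<Longrightarrow> M \<le> N \<Longrightarrow> slow_antiderivative N f"
  unfolding slow_antiderivative_def
  by (meson mult_right_mono order_trans real_sqrt_ge_zero less_imp_le)

text \<open>By the product-to-sum formulas only the frequencies \<open>s - k\<close> and
  \<open>s + k\<close> occur. As \<open>s\<close> and \<open>k\<close> are positive, the difference
  is the one closer to resonance. The constant 8 collects four coefficients of size at most
  \<open>K^2\<close>, each with the factor 2 of a single wave.\<close>

lemma slow_antiderivative_trig_product:
  fixes s k A B \<alpha> \<beta> K :: real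
  assumes "s > 0" "k > 0" "s \<noteq> k" "\<bar>A\<bar> \<le> K" "\<bar>B\<bar> \<le> K" "\<bar>\<alpha>\<bar> \<le> K" "\<bar>\<beta>\<bar> \<le> K"
  shows "slow_antiderivative (8 * K\<^sup>2 / sqrt \<bar>s - k\<bar>)
     (\<lambda>t. (A * cos (s * t) + B * sin (s * t)) * (\<alpha> * cos (k * t) + \<beta> * sin (k * t)))"
proof -
  have le: "2 / sqrt \<bar>s + k\<bar> \<le> 2 / sqrt \<bar>s - k\<bar>"
    using assms by (intro divide_left_mono) auto
  have m: "slow_antiderivative (2 / sqrt \<bar>s - k\<bar>) (\<lambda>t. cos ((s - k) * t))"
     "slow_antiderivative (2 / sqrt \<bar>s - k\<bar>) (\<lambda>t. sin ((s - k) * t))"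
     "slow_antiderivative (2 / sqrt \<bar>s - k\<bar>) (\<lambda>t. cos ((s + k) * t))"
     "slow_antiderivative (2 / sqrt \<bar>s - k\<bar>) (\<lambda>t. sin ((s + k) * t))"
    using slow_antiderivative_trig[of "s - k"] slow_antiderivative_trig[of "s + k"] assms
    by (auto intro: slow_antiderivative_mono[OF _ le])
  define c1 c2 c3 c4 where c: "c1 = (A * \<alpha> + B * \<beta>) / 2" "c2 = (B * \<alpha> - A * \<beta>) / 2"
    "c3 = (A * \<alpha> - B * \<beta>) / 2" "c4 = (A * \<beta> + B * \<alpha>) / 2"
  have K: "\<bar>x * y\<bar> \<le> K\<^sup>2" if "\<bar>x\<bar> \<le> K" "\<bar>y\<bar> \<le> K" for x y
    unfolding abs_mult power2_eq_square using that by (intro mult_mono) auto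
  note KK = K[OF assms(4,6)] K[OF assms(4,7)] K[OF assms(5,6)] K[OF assms(5,7)]
  have half: "\<bar>(x + y) / 2\<bar> \<le> K\<^sup>2" "\<bar>(x - y) / 2\<bar> \<le> K\<^sup>2" if "\<bar>x\<bar> \<le> K\<^sup>2" "\<bar>y\<bar> \<le> K\<^sup>2" for x y
    using that by (simp_all add: abs_le_iff)
  have cb: "\<bar>c1\<bar> \<le> K\<^sup>2" "\<bar>c2\<bar> \<le> K\<^sup>2" "\<bar>c3\<bar> \<le> K\<^sup>2" "\<bar>c4\<bar> \<le> K\<^sup>2"
    unfolding c by (intro half KK)+
  have eq: "(A * cos (s * t) + B * sin (s * t)) * (\<alpha> * cos (k * t) + \<beta> * sin (k * t))
      = c1 * cos ((s - k) * t) + c2 * sin ((s - k) * t) + c3 * cos ((s + k) * t) + c4 * sin ((s + k) * t)" for t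
    unfolding c distrib_right left_diff_distrib cos_add cos_diff sin_add sin_diff
    by (simp add: field_simps)
  have "slow_antiderivative (\<bar>c1\<bar> * (2 / sqrt \<bar>s - k\<bar>) + \<bar>c2\<bar> * (2 / sqrt \<bar>s - k\<bar>)
      + \<bar>c3\<bar> * (2 / sqrt \<bar>s - k\<bar>) + \<bar>c4\<bar> * (2 / sqrt \<bar>s - k\<bar>))
     (\<lambda>t. (A * cos (s * t) + B * sin (s * t)) * (\<alpha> * cos (k * t) + \<beta> * sin (k * t)))"
    unfolding eq by (intro slow_antiderivative_add slow_antiderivative_cmult m)
  moreover have "\<bar>c1\<bar> * (2 / sqrt \<bar>s - k\<bar>) + \<bar>c2\<bar> * (2 / sqrt \<bar>s - k\<bar>)
      + \<bar>c3\<bar> * (2 / sqrt \<bar>s - k\<bar>) + \<bar>c4\<bar> * (2 / sqrt \<bar>s - k\<bar>) \<le> 8 * K\<^sup>2 / sqrt \<bar>s - k\<bar>"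
  proof -
    have "(\<bar>c1\<bar> + \<bar>c2\<bar> + \<bar>c3\<bar> + \<bar>c4\<bar>) * (2 / sqrt \<bar>s - k\<bar>) \<le> (4 * K\<^sup>2) * (2 / sqrt \<bar>s - k\<bar>)"
      using cb by (intro mult_right_mono) auto
    then show ?thesis by (simp add: algebra_simps add_divide_distrib)
  qed
  ultimately show ?thesis by (rule slow_antiderivative_mono)
qed

text \<open>Each summand records one source of error: \<open>1 + 1 / s\<close> comes from the
  \<open>O(1/t)\<close> remainders at \<open>t\<close> and at \<open>t * s\<close>, the two roots
  from the resonances of frequency \<open>s\<close> with 1 and 3, and the outer
  \<open>1 / sqrt s\<close> from normalising \<open>J0(t * s)\<close> by
  \<open>sqrt (t * s)\<close>.\<close>

definition tail_weight :: "real \<Rightarrow> real" where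
  "tail_weight s = (1 + 1 / s + 1 / sqrt \<bar>s - 1\<bar> + 1 / sqrt \<bar>s - 3\<bar>) / sqrt s"

text \<open>This is the origin of the resonances 1 and 3. The form \<open>1 * t\<close> lets
  \<open>slow_antiderivative_trig_product\<close> match with \<open>k = 1\<close>.\<close>

lemma cube_trig_polynomial:
  fixes A B t :: real
  shows "(A * cos t + B * sin t) ^ 3 =
    ((3 * A ^ 3 + 3 * A * B\<^sup>2) / 4) * cos (1 * t) + ((3 * A\<^sup>2 * B + 3 * B ^ 3) / 4) * sin (1 * t)
    + (((A ^ 3 - 3 * A * B\<^sup>2) / 4) * cos (3 * t) + ((3 * A\<^sup>2 * B - B ^ 3) / 4) * sin (3 * t))"
proof -
  have c: "cos (3 * t) = 4 * cos t ^ 3 - 3 * cos t" by (rule cos_treble_cos)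
  have s: "sin (3 * t) = 4 * (cos t)\<^sup>2 * sin t - sin t"
  proof -
    have "sin (2 * t + t) = sin (2 * t) * cos t + cos (2 * t) * sin t" by (rule sin_add)
    also have "\<dots> = 4 * (cos t)\<^sup>2 * sin t - sin t"
      unfolding sin_double cos_double_cos by (simp add: power2_eq_square algebra_simps)
    finally show ?thesis by simp
  qed
  have 1: "(sin t)\<^sup>2 = 1 - (cos t)\<^sup>2" by (rule sin_squared_eq)
  have s3: "sin t ^ 3 = sin t - (cos t)\<^sup>2 * sin t"
  proof -
    have "sin t ^ 3 = (sin t)\<^sup>2 * sin t" by (simp add: power3_eq_cube power2_eq_square)
    then show ?thesis unfolding 1 by (simp add: left_diff_distrib)
  qed
  have "(A * cos t + B * sin t) ^ 3 = A ^ 3 * cos t ^ 3 + 3 * A\<^sup>2 * B * ((cos t)\<^sup>2 * sin t)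
      + 3 * A * B\<^sup>2 * (cos t * (sin t)\<^sup>2) + B ^ 3 * sin t ^ 3"
    by (simp add: power3_eq_cube power2_eq_square algebra_simps)
  also have "cos t * (sin t)\<^sup>2 = cos t - cos t ^ 3"
    unfolding 1 by (simp add: power3_eq_cube power2_eq_square algebra_simps)
  finally show ?thesis unfolding c s s3 mult_1 by (simp add: field_simps)
qed

text \<open>With \<open>u t = sqrt t * J0(t)\<close> the integrand equals
  \<open>u (t * s) * u t ^ 3 / (t * sqrt s)\<close>. Replacing \<open>u\<close> by its leading wave
  \<open>P\<close> gives an oscillating term \<open>\<psi> / t\<close> with a slow antiderivative,
  and the error \<open>e / t\<close> is of order \<open>1 / t^2\<close>, hence absolutely
  integrable. The constant \<open>K\<close> is uniform in \<open>s\<close>, as domination in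
  \<open>x\<close> requires.\<close>

lemma bessel_product_tail:
  obtains K where "K \<ge> 0"
    "\<And>s a R. s > 0 \<Longrightarrow> s \<noteq> 1 \<Longrightarrow> s \<noteq> 3 \<Longrightarrow> 1 \<le> a \<Longrightarrow> a \<le> R \<Longrightarrow>
       \<bar>integral {a..R} (\<lambda>t. t * bessel_J0 (t * s) * bessel_J0 t ^ 3)\<bar> \<le> K * tail_weight s / sqrt a"
proof -
  obtain A B C where ABC:
    "\<And>t. t > 0 \<Longrightarrow> \<bar>sqrt t * bessel_J0 t - (A * cos t + B * sin t)\<bar> \<le> C / t"
    "\<And>t. t \<ge> 0 \<Longrightarrow> \<bar>bessel_J0 t\<bar> \<le> C"
    "\<And>t. t \<ge> 0 \<Longrightarrow> \<bar>sqrt t * bessel_J0 t\<bar> \<le> C"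
    by (rule bessel_J0_asymptotics) blast
  have "C \<ge> 0" using ABC(2)[of 0] by auto
  define u where "u t = sqrt t * bessel_J0 t" for t
  define P where "P t = A * cos t + B * sin t" for t
  define K0 where "K0 = C + \<bar>A\<bar> + \<bar>B\<bar>"
  define \<alpha>1 where "\<alpha>1 = (3 * A ^ 3 + 3 * A * B\<^sup>2) / 4"
  define \<beta>1 where "\<beta>1 = (3 * A\<^sup>2 * B + 3 * B ^ 3) / 4"
  define \<alpha>3 where "\<alpha>3 = (A ^ 3 - 3 * A * B\<^sup>2) / 4"
  define \<beta>3 where "\<beta>3 = (3 * A\<^sup>2 * B - B ^ 3) / 4"
  define K1 where "K1 = \<bar>A\<bar> + \<bar>B\<bar> + \<bar>\<alpha>1\<bar> + \<bar>\<beta>1\<bar> + \<bar>\<alpha>3\<bar> + \<bar>\<beta>3\<bar>"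
  have "K0 \<ge> 0" using \<open>C \<ge> 0\<close> by (simp add: K0_def)
  have ub: "\<bar>u t\<bar> \<le> K0" if "t > 0" for t
    using ABC(3)[of t] that by (simp add: u_def K0_def)
  have Pb: "\<bar>P t\<bar> \<le> K0" for t
  proof -
    have "\<bar>A * cos t\<bar> \<le> \<bar>A\<bar>" "\<bar>B * sin t\<bar> \<le> \<bar>B\<bar>"
      by (auto simp: abs_mult intro!: mult_left_le)
    then show ?thesis using \<open>C \<ge> 0\<close> by (simp add: P_def K0_def)
  qed
  have uP: "\<bar>u t - P t\<bar> \<le> C / t" if "t > 0" for t
    using ABC(1)[OF that] by (simp add: u_def P_def)
  \<comment> \<open>Here 32 is the factor 4 of \<open>sqrt_antiderivative_integral_bound\<close>
    times the 8 of the trigonometric products; the other summand bounds the error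
    \<open>e\<close>.\<close>
  define K where "K = 32 * K1\<^sup>2 + 3 * K0 ^ 3 * C"
  have "K \<ge> 0" using \<open>C \<ge> 0\<close> \<open>K0 \<ge> 0\<close> by (simp add: K_def)
  show thesis
  proof (rule that[OF \<open>K \<ge> 0\<close>])
    fix s a R :: real
    assume s: "s > 0" "s \<noteq> 1" "s \<noteq> 3" and aR: "1 \<le> a" "a \<le> R"
    define \<psi> where "\<psi> t = P (s * t) * P t ^ 3" for t
    define e where "e t = u (t * s) * u t ^ 3 - \<psi> t" for t
    have cont\<psi>: "continuous_on S \<psi>" for S
      unfolding \<psi>_def[abs_def] P_def by (intro continuous_intros)
    have conte: "continuous_on S e" for S
      unfolding e_def[abs_def] u_def by (intro continuous_intros cont\<psi>)
    have "slow_antiderivative (8 * K1\<^sup>2 / sqrt \<bar>s - 1\<bar> + 8 * K1\<^sup>2 / sqrt \<bar>s - 3\<bar>) \<psi>"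
    proof -
      have \<psi>_eq: "\<psi> = (\<lambda>t. (A * cos (s * t) + B * sin (s * t)) * (\<alpha>1 * cos (1 * t) + \<beta>1 * sin (1 * t))
          + (A * cos (s * t) + B * sin (s * t)) * (\<alpha>3 * cos (3 * t) + \<beta>3 * sin (3 * t)))"
        unfolding \<psi>_def[abs_def] P_def cube_trig_polynomial
          \<alpha>1_def[symmetric] \<beta>1_def[symmetric] \<alpha>3_def[symmetric] \<beta>3_def[symmetric]
        by (simp only: distrib_left)
      show ?thesis unfolding \<psi>_eq
        by (intro slow_antiderivative_add slow_antiderivative_trig_product)
           (use s in \<open>auto simp: K1_def\<close>)
    qed
    then obtain \<Psi> where \<Psi>: "\<And>t. t > 0 \<Longrightarrow> (\<Psi> has_real_derivative \<psi> t) (at t)"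
       "\<And>t. t > 0 \<Longrightarrow> \<bar>\<Psi> t\<bar> \<le> (8 * K1\<^sup>2 / sqrt \<bar>s - 1\<bar> + 8 * K1\<^sup>2 / sqrt \<bar>s - 3\<bar>) * sqrt t"
      unfolding slow_antiderivative_def by blast
    have I1: "\<bar>integral {a..R} (\<lambda>t. \<psi> t / t)\<bar>
        \<le> 4 * (8 * K1\<^sup>2 / sqrt \<bar>s - 1\<bar> + 8 * K1\<^sup>2 / sqrt \<bar>s - 3\<bar>) / sqrt a"
      using aR by (intro sqrt_antiderivative_integral_bound[OF \<Psi> cont\<psi>]) auto
    define E where "E = 3 * K0 ^ 3 * C * (1 + 1 / s)"
    have "E \<ge> 0" using \<open>C \<ge> 0\<close> \<open>K0 \<ge> 0\<close> s by (simp add: E_def)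
    have eb: "\<bar>e t\<bar> \<le> E / t" if "t > 0" for t
    proof -
      have ts: "t * s > 0" using that s by simp
      \<comment> \<open>Telescoping: one factor \<open>u\<close> at a time is exchanged for
        \<open>P\<close>, with \<open>u^3 - P^3\<close> factored through
        \<open>u - P\<close>.\<close>
      have "e t = (u (t * s) - P (t * s)) * u t ^ 3
          + P (t * s) * ((u t - P t) * ((u t)\<^sup>2 + u t * P t + (P t)\<^sup>2))"
        by (simp add: e_def \<psi>_def algebra_simps power2_eq_square power3_eq_cube)
      also have "\<bar>\<dots>\<bar> \<le> \<bar>u (t * s) - P (t * s)\<bar> * \<bar>u t\<bar> ^ 3
          + \<bar>P (t * s)\<bar> * (\<bar>u t - P t\<bar> * (\<bar>u t\<bar>\<^sup>2 + \<bar>u t\<bar> * \<bar>P t\<bar> + \<bar>P t\<bar>\<^sup>2))"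
      proof (rule order_trans[OF abs_triangle_ineq add_mono])
        have "\<bar>(u t)\<^sup>2 + u t * P t + (P t)\<^sup>2\<bar> \<le> \<bar>u t\<bar>\<^sup>2 + \<bar>u t\<bar> * \<bar>P t\<bar> + \<bar>P t\<bar>\<^sup>2"
          using abs_triangle_ineq[of "(u t)\<^sup>2 + u t * P t" "(P t)\<^sup>2"] abs_triangle_ineq[of "(u t)\<^sup>2" "u t * P t"]
          by (simp add: abs_mult)
        then show "\<bar>P (t * s) * ((u t - P t) * ((u t)\<^sup>2 + u t * P t + (P t)\<^sup>2))\<bar>
            \<le> \<bar>P (t * s)\<bar> * (\<bar>u t - P t\<bar> * (\<bar>u t\<bar>\<^sup>2 + \<bar>u t\<bar> * \<bar>P t\<bar> + \<bar>P t\<bar>\<^sup>2))"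
          unfolding abs_mult by (intro mult_left_mono abs_ge_zero)
      qed (simp add: abs_mult power_abs)
      also have "\<dots> \<le> C / (t * s) * K0 ^ 3 + K0 * (C / t * (K0\<^sup>2 + K0 * K0 + K0\<^sup>2))"
        using \<open>K0 \<ge> 0\<close> \<open>C \<ge> 0\<close> ts that
        by (intro add_mono mult_mono power_mono ub Pb uP) auto
      also have "\<dots> = (K0 ^ 3 * C * (1 / s) + 3 * K0 ^ 3 * C) / t"
        using that s by (simp add: field_simps power2_eq_square power3_eq_cube)
      also have "\<dots> \<le> E / t"
        using \<open>C \<ge> 0\<close> \<open>K0 \<ge> 0\<close> s that unfolding E_def
        by (intro divide_right_mono) (auto simp: algebra_simps divide_right_mono)
      finally show ?thesis .
    qed
    have i\<psi>: "(\<lambda>t. \<psi> t / t) integrable_on {a..R}" and ie: "(\<lambda>t. e t / t) integrable_on {a..R}"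
      using aR by (auto intro!: integrable_continuous_real continuous_intros cont\<psi> conte)
    have I2: "\<bar>integral {a..R} (\<lambda>t. e t / t)\<bar> \<le> E / sqrt a"
    proof -
      have 2: "((\<lambda>t. E / t\<^sup>2) has_integral (- E / R - - E / a)) {a..R}"
      proof (rule fundamental_theorem_of_calculus[OF aR(2)])
        fix x assume "x \<in> {a..R}"
        then have x: "x > 0" using aR by auto
        have "((\<lambda>t. - E / t) has_real_derivative E / x\<^sup>2) (at x)"
          using x by (auto intro!: derivative_eq_intros simp: field_simps power2_eq_square)
        then show "((\<lambda>t. - E / t) has_vector_derivative E / x\<^sup>2) (at x within {a..R})"
          by (simp add: has_real_derivative_iff_has_vector_derivative has_vector_derivative_at_within)
      qed
      have "\<bar>integral {a..R} (\<lambda>t. e t / t)\<bar> \<le> integral {a..R} (\<lambda>t. E / t\<^sup>2)"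
        unfolding real_norm_def[symmetric]
      proof (rule integral_norm_bound_integral[OF ie])
        fix x assume "x \<in> {a..R}"
        then have x: "x > 0" using aR by auto
        then have "\<bar>e x\<bar> / x \<le> E / x / x" using eb by (intro divide_right_mono) auto
        then show "norm (e x / x) \<le> E / x\<^sup>2" using x by (simp add: power2_eq_square)
      qed (use 2 in blast)
      also have "\<dots> = - E / R - - E / a" by (rule integral_unique[OF 2])
      also have "\<dots> \<le> E / a" using \<open>E \<ge> 0\<close> aR by simp
      also have "E / a \<le> E / sqrt a" using \<open>E \<ge> 0\<close> aR real_sqrt_le_iff[of a "a\<^sup>2"]
        by (intro divide_left_mono) (auto simp: power2_eq_square)
      finally show ?thesis .
    qed
    have eq: "t * bessel_J0 (t * s) * bessel_J0 t ^ 3 = 1 / sqrt s * (\<psi> t / t + e t / t)"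
      if "t \<in> {a..R}" for t
    proof -
      have t: "t > 0" using that aR by auto
      have "\<psi> t / t + e t / t = u (t * s) * u t ^ 3 / t" by (simp add: e_def flip: add_divide_distrib)
      also have "\<dots> = (sqrt t * sqrt t) * (sqrt t * sqrt t) * sqrt s * bessel_J0 (t * s) * bessel_J0 t ^ 3 / t"
        by (simp add: u_def real_sqrt_mult power3_eq_cube algebra_simps del: real_sqrt_mult_self)
      also have "\<dots> = sqrt s * (t * bessel_J0 (t * s) * bessel_J0 t ^ 3)" using t by simp
      finally show ?thesis using s by simp
    qed
    have "integral {a..R} (\<lambda>t. t * bessel_J0 (t * s) * bessel_J0 t ^ 3)
        = integral {a..R} (\<lambda>t. 1 / sqrt s * (\<psi> t / t + e t / t))"
      by (rule integral_cong) (rule eq)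
    also have "\<dots> = 1 / sqrt s * (integral {a..R} (\<lambda>t. \<psi> t / t) + integral {a..R} (\<lambda>t. e t / t))"
      by (simp add: integral_add[OF i\<psi> ie])
    also have "\<bar>\<dots>\<bar> = 1 / sqrt s * \<bar>integral {a..R} (\<lambda>t. \<psi> t / t) + integral {a..R} (\<lambda>t. e t / t)\<bar>"
      using s by (simp add: abs_mult)
    also have "\<dots> \<le> 1 / sqrt s * (4 * (8 * K1\<^sup>2 / sqrt \<bar>s - 1\<bar> + 8 * K1\<^sup>2 / sqrt \<bar>s - 3\<bar>) / sqrt a + E / sqrt a)"
      using s I1 I2 by (intro mult_left_mono) auto
    also have "\<dots> = 1 / sqrt s * (32 * K1\<^sup>2 * (1 / sqrt \<bar>s - 1\<bar> + 1 / sqrt \<bar>s - 3\<bar>) + 3 * K0 ^ 3 * C * (1 + 1 / s)) / sqrt a"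
      by (simp add: E_def algebra_simps add_divide_distrib)
    also have "\<dots> \<le> 1 / sqrt s * (K * (1 / sqrt \<bar>s - 1\<bar> + 1 / sqrt \<bar>s - 3\<bar>) + K * (1 + 1 / s)) / sqrt a"
      using s aR \<open>C \<ge> 0\<close> \<open>K0 \<ge> 0\<close>
      by (intro divide_right_mono mult_left_mono add_mono mult_right_mono) (auto simp: K_def)
    also have "\<dots> = K * tail_weight s / sqrt a"
      by (simp add: tail_weight_def algebra_simps add_divide_distrib)
    finally show "\<bar>integral {a..R} (\<lambda>t. t * bessel_J0 (t * s) * bessel_J0 t ^ 3)\<bar> \<le> K * tail_weight s / sqrt a" .
  qed
qed

text \<open>The Cauchy criterion yields a limit along the integers; passing to the limit in the tail
  bound then extends convergence to real \<open>R\<close>.\<close>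

lemma convergent_of_sqrt_tail:
  fixes F :: "real \<Rightarrow> real"
  assumes tail: "\<And>a R. 1 \<le> a \<Longrightarrow> a \<le> R \<Longrightarrow> \<bar>F R - F a\<bar> \<le> K / sqrt a"
  obtains L where "(F \<longlongrightarrow> L) at_top"
proof -
  have lim0: "((\<lambda>R. K / sqrt R) \<longlongrightarrow> 0) at_top"
    by (rule real_tendsto_divide_at_top[OF tendsto_const sqrt_at_top])
  have "Cauchy (\<lambda>n. F (real n))"
  proof (rule CauchyI')
    fix \<epsilon> :: real assume "\<epsilon> > 0"
    have "\<forall>\<^sub>F R in at_top. K / sqrt R < \<epsilon> \<and> 1 \<le> R"
      using order_tendstoD(2)[OF lim0 \<open>\<epsilon> > 0\<close>] eventually_ge_at_top[of 1] by eventually_elim auto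
    then have "\<forall>\<^sub>F n in sequentially. K / sqrt (real n) < \<epsilon> \<and> 1 \<le> real n"
      by (rule filterlim_real_sequentially[unfolded filterlim_iff, rule_format])
    then obtain N where N: "\<And>n. n \<ge> N \<Longrightarrow> K / sqrt (real n) < \<epsilon> \<and> 1 \<le> real n"
      unfolding eventually_sequentially by blast
    have "dist (F (real m)) (F (real n)) < \<epsilon>" if "m \<ge> N" "n > m" for m n
      using N[OF that(1)] tail[of "real m" "real n"] that by (auto simp: dist_real_def abs_minus_commute)
    then show "\<exists>N. \<forall>m\<ge>N. \<forall>n>m. dist (F (real m)) (F (real n)) < \<epsilon>" by blast
  qed
  then obtain L where L: "(\<lambda>n. F (real n)) \<longlonglongrightarrow> L"
    using Cauchy_convergent_iff convergent_def by blast
  have bnd: "\<bar>F R - L\<bar> \<le> K / sqrt R" if "R \<ge> 1" for R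
  proof -
    have "(\<lambda>n. \<bar>F (real n) - F R\<bar>) \<longlonglongrightarrow> \<bar>L - F R\<bar>" by (intro tendsto_intros L)
    moreover have "\<forall>\<^sub>F n in sequentially. \<bar>F (real n) - F R\<bar> \<le> K / sqrt R"
      using filterlim_real_sequentially[unfolded filterlim_at_top, rule_format, of R]
      by eventually_elim (use tail that in auto)
    ultimately have "\<bar>L - F R\<bar> \<le> K / sqrt R" by (rule tendsto_upperbound) simp
    then show ?thesis by (simp add: abs_minus_commute)
  qed
  have "((\<lambda>R. F R - L) \<longlongrightarrow> 0) at_top"
    by (rule Lim_null_comparison[OF _ lim0])
       (use bnd in \<open>auto intro: eventually_mono[OF eventually_ge_at_top[of 1]]\<close>)
  then show ?thesis using that LIM_zero_iff by blast
qed

subsection \<open>Truncated Bessel integrals\<close>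

definition bessel_partial :: "real \<Rightarrow> real \<Rightarrow> real" where
  "bessel_partial R x = (LBINT t:{0..R}. t * bessel_J0 (t * sqrt x) * bessel_J0 t ^ 3)"

lemma triangular_density_eq_Lim:
  "x > 0 \<Longrightarrow> triangular_density x = 1 / 2 * Lim at_top (\<lambda>R. bessel_partial R x)"
  by (simp add: triangular_density_def bessel_partial_def)

lemma continuous_on_bessel_integrand:
  "continuous_on S (\<lambda>t. t * bessel_J0 (t * s) * bessel_J0 t ^ 3)"
  by (intro continuous_intros)

lemma bessel_partial_eq_integral:
  "bessel_partial R x = integral {0..R} (\<lambda>t. t * bessel_J0 (t * sqrt x) * bessel_J0 t ^ 3)"
  unfolding bessel_partial_def
  by (intro set_borel_integral_eq_integral borel_integrable_atLeastAtMost' continuous_on_bessel_integrand)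

lemma bessel_partial_diff:
  assumes "0 \<le> a" "a \<le> R"
  shows "bessel_partial R x - bessel_partial a x =
    integral {a..R} (\<lambda>t. t * bessel_J0 (t * sqrt x) * bessel_J0 t ^ 3)"
  unfolding bessel_partial_eq_integral
  using Henstock_Kurzweil_Integration.integral_combine[OF assms, of "\<lambda>t. t * bessel_J0 (t * sqrt x) * bessel_J0 t ^ 3"]
  by (simp add: integrable_continuous_real continuous_on_bessel_integrand)

text \<open>Away from the resonances \<open>sqrt x = 1\<close> and \<open>sqrt x = 3\<close> the
  tail bound makes the improper integral converge, so \<open>Lim\<close> denotes a genuine limit.
  The two exceptional points form a null set.\<close>

lemma bessel_partial_tendsto:
  assumes "x > 0" "x \<noteq> 1" "x \<noteq> 9"
  shows "((\<lambda>R. bessel_partial R x) \<longlongrightarrow> 2 * triangular_density x) at_top"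
proof -
  have x: "sqrt x > 0" "sqrt x \<noteq> 1" "sqrt x \<noteq> 3"
    using assms real_sqrt_eq_iff[of x 9] real_sqrt_unique[of 3 9] by auto
  obtain K where K: "\<And>s a R. s > 0 \<Longrightarrow> s \<noteq> 1 \<Longrightarrow> s \<noteq> 3 \<Longrightarrow> 1 \<le> a \<Longrightarrow> a \<le> R \<Longrightarrow>
       \<bar>integral {a..R} (\<lambda>t. t * bessel_J0 (t * s) * bessel_J0 t ^ 3)\<bar> \<le> K * tail_weight s / sqrt a"
    by (rule bessel_product_tail) blast
  obtain L where L: "((\<lambda>R. bessel_partial R x) \<longlongrightarrow> L) at_top"
  proof (rule convergent_of_sqrt_tail)
    show "\<bar>bessel_partial R x - bessel_partial a x\<bar> \<le> K * tail_weight (sqrt x) / sqrt a"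
      if "1 \<le> a" "a \<le> R" for a R
      using K[OF x that] bessel_partial_diff[of a R x] that by simp
  qed
  have "2 * triangular_density x = L"
    using triangular_density_eq_Lim[OF assms(1)] tendsto_Lim[OF _ L] by simp
  with L show ?thesis by simp
qed

text \<open>This is the majorant for dominated convergence as \<open>R\<close> tends to infinity:
  the range \<open>t \<le> 1\<close> contributes at most \<open>C ^ 4\<close>, and the rest is the
  tail estimate started at 1.\<close>

lemma bessel_partial_bound:
  obtains K where "K \<ge> 0"
    "\<And>R x. R \<ge> 1 \<Longrightarrow> x > 0 \<Longrightarrow> x \<noteq> 1 \<Longrightarrow> x \<noteq> 9 \<Longrightarrow> \<bar>bessel_partial R x\<bar> \<le> K * (1 + tail_weight (sqrt x))"
proof -
  obtain K where "K \<ge> 0" and K: "\<And>s a R. s > 0 \<Longrightarrow> s \<noteq> 1 \<Longrightarrow> s \<noteq> 3 \<Longrightarrow> 1 \<le> a \<Longrightarrow> a \<le> R \<Longrightarrow>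
       \<bar>integral {a..R} (\<lambda>t. t * bessel_J0 (t * s) * bessel_J0 t ^ 3)\<bar> \<le> K * tail_weight s / sqrt a"
    by (rule bessel_product_tail) blast
  obtain C where C: "\<And>t. t \<ge> 0 \<Longrightarrow> \<bar>bessel_J0 t\<bar> \<le> C"
    by (rule bessel_J0_asymptotics) blast
  have "C \<ge> 0" using C[of 0] by auto
  have one: "\<bar>bessel_partial 1 x\<bar> \<le> C ^ 4" for x
  proof -
    have "norm (integral (cbox 0 1) (\<lambda>t. t * bessel_J0 (t * sqrt x) * bessel_J0 t ^ 3))
        \<le> C ^ 4 * Henstock_Kurzweil_Integration.content (cbox 0 (1::real))"
    proof (rule integrable_bound)
      fix t :: real assume "t \<in> cbox 0 1"
      then have t: "0 \<le> t" "t \<le> 1" by auto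
      have "\<bar>bessel_J0 (t * sqrt x)\<bar> \<le> C"
      proof (cases "x \<ge> 0")
        case False
        \<comment> \<open>The function \<open>sqrt\<close> is odd on the reals and
          \<open>bessel_J0\<close> is even, so negative \<open>x\<close> reduces to
          \<open>- x\<close>.\<close>
        have "bessel_J0 (- y) = bessel_J0 y" for y by (simp add: bessel_J0_eq)
        then have "bessel_J0 (t * sqrt x) = bessel_J0 (t * sqrt (- x))"
          by (simp add: real_sqrt_minus)
        then show ?thesis using C[of "t * sqrt (- x)"] t False by simp
      qed (use C t in auto)
      then have "\<bar>t\<bar> * \<bar>bessel_J0 (t * sqrt x)\<bar> * \<bar>bessel_J0 t\<bar> ^ 3 \<le> 1 * C * C ^ 3"
        using t C[of t] \<open>C \<ge> 0\<close> by (intro mult_mono power_mono) auto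
      then show "norm (t * bessel_J0 (t * sqrt x) * bessel_J0 t ^ 3) \<le> C ^ 4"
        by (simp add: abs_mult power_abs flip: power_Suc)
    qed (use \<open>C \<ge> 0\<close> in \<open>auto intro!: integrable_continuous_real continuous_on_bessel_integrand\<close>)
    then show ?thesis by (simp add: bessel_partial_eq_integral)
  qed
  show thesis
  proof (rule that[of "C ^ 4 + K"])
    fix R x :: real
    assume R: "R \<ge> 1" and x: "x > 0" "x \<noteq> 1" "x \<noteq> 9"
    have s: "sqrt x > 0" "sqrt x \<noteq> 1" "sqrt x \<noteq> 3"
      using x real_sqrt_eq_iff[of x 9] real_sqrt_unique[of 3 9] by auto
    have w: "tail_weight (sqrt x) \<ge> 0" using s by (simp add: tail_weight_def)
    have "\<bar>bessel_partial R x - bessel_partial 1 x\<bar> \<le> K * tail_weight (sqrt x)"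
      using K[OF s order_refl R] bessel_partial_diff[of 1 R x] R by simp
    then have "\<bar>bessel_partial R x\<bar> \<le> C ^ 4 + K * tail_weight (sqrt x)" using one[of x] by linarith
    also have "\<dots> \<le> (C ^ 4 + K) * (1 + tail_weight (sqrt x))"
      using w \<open>K \<ge> 0\<close> \<open>C \<ge> 0\<close> by (simp add: algebra_simps)
    finally show "\<bar>bessel_partial R x\<bar> \<le> (C ^ 4 + K) * (1 + tail_weight (sqrt x))" .
  qed (use \<open>K \<ge> 0\<close> \<open>C \<ge> 0\<close> in auto)
qed

section \<open>Integrable majorants for the singularities\<close>

text \<open>Replacing both bases by the smaller one adds the exponents. This separates a product of
  singularities at different points into a sum, and it is the origin of the exponent
  \<open>-3/4\<close>, which is still integrable.\<close>

lemma powr_product_le_sum: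
  fixes a b :: real
  assumes "a > 0" "b > 0"
  shows "a powr (-1/4) * b powr (-1/2) \<le> a powr (-3/4) + b powr (-3/4)"
proof (cases "b \<le> a")
  case True
  have "a powr (-1/4) * b powr (-1/2) \<le> b powr (-1/4) * b powr (-1/2)"
    using True assms by (intro mult_right_mono powr_mono2') auto
  also have "\<dots> = b powr (-3/4)" by (simp flip: powr_add)
  finally show ?thesis by (simp add: add_increasing)
next
  case False
  have "a powr (-1/4) * b powr (-1/2) \<le> a powr (-1/4) * a powr (-1/2)"
    using False assms by (intro mult_left_mono powr_mono2') auto
  also have "\<dots> = a powr (-3/4)" by (simp flip: powr_add)
  finally show ?thesis by (simp add: add_increasing2)
qed

lemma powr_neg_1_2_le:
  fixes b :: real
  assumes "b > 0"
  shows "b powr (-1/2) \<le> 1 + b powr (-3/4)"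
proof (cases "b \<ge> 1")
  case True
  then have "b powr (-1/2) \<le> 1 powr (-1/2)" by (intro powr_mono2') auto
  then show ?thesis by (simp add: add_increasing2)
next
  case False
  then have "b powr (-1/2) \<le> b powr (-3/4)" using assms by (intro powr_mono') auto
  then show ?thesis by simp
qed

text \<open>For \<open>x = s^2\<close> one has \<open>|s - k| = |x - k^2| / (s + k)\<close>, so a
  root singularity in \<open>s\<close> becomes one in \<open>x\<close> at \<open>k^2\<close>, with
  the extra factor \<open>sqrt (s + k) / sqrt s\<close>. That factor is at most
  \<open>1 + 2 * x powr (-1/4)\<close>, and the product with the singularity is split by
  \<open>powr_product_le_sum\<close>.\<close>

lemma tail_weight_bound:
  assumes x: "x > 0" "x \<noteq> 1" "x \<noteq> 9"
  shows "tail_weight (sqrt x) \<le> 10 * (1 + x powr (-3/4) + \<bar>x - 1\<bar> powr (-3/4) + \<bar>x - 9\<bar> powr (-3/4))"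
proof -
  define s where "s = sqrt x"
  have s: "s > 0" "s \<noteq> 1" "s \<noteq> 3" "x = s\<^sup>2"
    using x real_sqrt_eq_iff[of x 9] real_sqrt_unique[of 3 9] by (auto simp: s_def)
  have s14: "1 / sqrt s = x powr (-1/4)"
    using s(1) by (simp add: s(4) powr_half_sqrt[symmetric] powr_powr powr_minus_divide flip: powr_numeral)
  have s34: "1 / s / sqrt s = x powr (-3/4)"
  proof -
    have "1 / s / sqrt s = s powr (-1) * s powr (-1/2)"
      using s(1) by (simp add: powr_minus_divide powr_half_sqrt[symmetric])
    also have "\<dots> = s powr (2 * (-3/4))" by (simp only: powr_add[symmetric]) simp
    also have "\<dots> = x powr (-3/4)" using s(1) by (simp add: s(4) powr_powr flip: powr_numeral)
    finally show ?thesis .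
  qed
  have x14: "x powr (-1/4) \<le> 1 + x powr (-3/4)"
  proof (cases "x \<ge> 1")
    case True
    then have "x powr (-1/4) \<le> 1 powr (-1/4)" by (intro powr_mono2') auto
    then show ?thesis by (simp add: add_increasing2)
  next
    case False
    then have "x powr (-1/4) \<le> x powr (-3/4)" using x by (intro powr_mono') auto
    then show ?thesis by simp
  qed
  have main: "1 / sqrt \<bar>s - k\<bar> / sqrt s \<le> 1 + \<bar>x - k\<^sup>2\<bar> powr (-3/4) + 2 * (x powr (-3/4) + \<bar>x - k\<^sup>2\<bar> powr (-3/4))"
    if k: "k > 0" "s \<noteq> k" "k \<le> 4" for k
  proof -
    have "x - k\<^sup>2 = (s - k) * (s + k)" by (simp add: s(4) power2_eq_square algebra_simps)
    then have "\<bar>x - k\<^sup>2\<bar> = \<bar>s - k\<bar> * (s + k)" using s k by (simp add: abs_mult)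
    then have "sqrt \<bar>x - k\<^sup>2\<bar> = sqrt \<bar>s - k\<bar> * sqrt (s + k)" by (simp add: real_sqrt_mult)
    moreover have nz: "\<bar>x - k\<^sup>2\<bar> > 0" using s k by (simp add: s(4) power2_eq_iff)
    ultimately have "1 / sqrt \<bar>s - k\<bar> = sqrt (s + k) / sqrt \<bar>x - k\<^sup>2\<bar>" using s k by simp
    then have "1 / sqrt \<bar>s - k\<bar> / sqrt s = sqrt (s + k) / sqrt s / sqrt \<bar>x - k\<^sup>2\<bar>" by simp
    also have "\<dots> \<le> (sqrt s + 2) / sqrt s / sqrt \<bar>x - k\<^sup>2\<bar>"
    proof -
      have "sqrt (s + k) \<le> sqrt s + sqrt k" using s k by (intro sqrt_add_le_add_sqrt) auto
      also have "sqrt k \<le> 2" using k real_sqrt_le_mono[of k 4] by simp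
      finally show ?thesis using s by (intro divide_right_mono) auto
    qed
    also have "\<dots> = \<bar>x - k\<^sup>2\<bar> powr (-1/2) + 2 * (x powr (-1/4) * \<bar>x - k\<^sup>2\<bar> powr (-1/2))"
    proof -
      have "\<bar>x - k\<^sup>2\<bar> powr (-1/2) = 1 / sqrt \<bar>x - k\<^sup>2\<bar>"
        using nz by (simp add: powr_minus_divide powr_half_sqrt[symmetric])
      then show ?thesis using s(1) unfolding s14[symmetric] by (simp add: add_divide_distrib)
    qed
    also have "\<dots> \<le> 1 + \<bar>x - k\<^sup>2\<bar> powr (-3/4) + 2 * (x powr (-3/4) + \<bar>x - k\<^sup>2\<bar> powr (-3/4))"
      by (intro add_mono mult_left_mono powr_product_le_sum powr_neg_1_2_le nz x(1)) auto
    finally show ?thesis .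
  qed
  have "tail_weight s = 1 / sqrt s + 1 / s / sqrt s + 1 / sqrt \<bar>s - 1\<bar> / sqrt s + 1 / sqrt \<bar>s - 3\<bar> / sqrt s"
    by (simp add: tail_weight_def add_divide_distrib)
  moreover have "0 \<le> \<bar>x - 1\<bar> powr (-3/4)" "0 \<le> \<bar>x - 9\<bar> powr (-3/4)" "0 \<le> x powr (-3/4)" by auto
  moreover have "1 / sqrt \<bar>s - 1\<bar> / sqrt s
      \<le> 1 + \<bar>x - 1\<bar> powr (-3/4) + 2 * (x powr (-3/4) + \<bar>x - 1\<bar> powr (-3/4))"
    using main[of 1] s(2) by simp
  moreover have "1 / sqrt \<bar>s - 3\<bar> / sqrt s
      \<le> 1 + \<bar>x - 9\<bar> powr (-3/4) + 2 * (x powr (-3/4) + \<bar>x - 9\<bar> powr (-3/4))"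
    using main[of 3] s(3) by simp
  \<comment> \<open>Linear bookkeeping: \<open>i\<close>, \<open>p\<close>, \<open>a\<close> and
    \<open>b\<close> stand for the four summands of \<open>tail_weight\<close>, and
    \<open>p\<close>, \<open>q\<close>, \<open>r\<close> for the singular powers at 0, 1 and
    9.\<close>
  moreover have "w \<le> 10 * (1 + p + q + r)"
    if "w = i + p + a + b" "0 \<le> q" "0 \<le> r" "0 \<le> p" "a \<le> 1 + q + 2 * (p + q)"
      "b \<le> 1 + r + 2 * (p + r)" "i \<le> 1 + p" for w p q r i a b :: real
    using that by argo
  ultimately show ?thesis using x14 unfolding s_def[symmetric] s14 s34 by blast
qed

subsection \<open>Laplace and Gauss integrals of the Bessel function\<close>

text \<open>Within distance 1 of \<open>a\<close> the function is dominated by a translate or a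
  reflection of \<open>y powr (-3/4)\<close> on \<open>{0..1}\<close>; further away the power is at
  most 1 and the exponential alone suffices.\<close>

lemma powr_singularity_integrable:
  fixes l a :: real
  assumes "l > 0"
  shows "integrable lborel (\<lambda>x. indicator {0<..} x * (exp (- l * x) * \<bar>x - a\<bar> powr (-3/4)))"
proof -
  define g :: "real \<Rightarrow> real" where "g y = indicator {0..1} y * y powr (-3/4)" for y
  have g: "integrable lborel g"
  proof -
    have "(\<lambda>y::real. y powr (-3/4)) absolutely_integrable_on {0..1}"
      by (intro nonnegative_absolutely_integrable_1 integrable_on_powr_from_0) auto
    then have "set_integrable lborel {0..1} (\<lambda>y::real. y powr (-3/4))"
      unfolding set_integrable_def by (subst (asm) integrable_completion) auto
    then show ?thesis by (simp add: set_integrable_def g_def[abs_def])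
  qed
  have g1: "integrable lborel (\<lambda>x. g (- a + 1 * x))" and g2: "integrable lborel (\<lambda>x. g (a + (-1) * x))"
    by (intro lborel_integrable_real_affine g; simp)+
  have e: "integrable lborel (\<lambda>x. indicator {0<..} x * exp (- l * x))"
    using integrable_I0i_exp_mscale[OF assms] by (simp add: set_integrable_def mult.commute)
  show ?thesis
  proof (rule Bochner_Integration.integrable_bound)
    show "integrable lborel (\<lambda>x. indicator {0<..} x * exp (- l * x) + g (- a + 1 * x) + g (a + (-1) * x))"
      by (intro Bochner_Integration.integrable_add e g1 g2)
    show "AE x in lborel. norm (indicator {0<..} x * (exp (- l * x) * \<bar>x - a\<bar> powr (-3/4)))
        \<le> norm (indicator {0<..} x * exp (- l * x) + g (- a + 1 * x) + g (a + (-1) * x))"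
    proof (rule AE_I2)
      fix x :: real
      have pos: "0 \<le> g y" for y by (simp add: g_def)
      have "exp (- l * x) * \<bar>x - a\<bar> powr (-3/4) \<le> exp (- l * x) + g (- a + 1 * x) + g (a + (-1) * x)"
        if "x > 0"
      proof (cases "\<bar>x - a\<bar> \<le> 1")
        case True
        have "exp (- l * x) * \<bar>x - a\<bar> powr (-3/4) \<le> 1 * \<bar>x - a\<bar> powr (-3/4)"
          using that assms by (intro mult_right_mono) auto
        also have "\<dots> \<le> g (- a + 1 * x) + g (a + (-1) * x)"
          using True pos by (cases "x \<ge> a") (auto simp: g_def abs_if indicator_def)
        finally show ?thesis using exp_ge_zero[of "- l * x"] by linarith
      next
        case False
        have "\<bar>x - a\<bar> powr (-3/4) \<le> 1 powr (-3/4)" using False by (intro powr_mono2') auto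
        then have "exp (- l * x) * \<bar>x - a\<bar> powr (-3/4) \<le> exp (- l * x)"
          by (simp add: mult_left_le)
        then show ?thesis using pos[of "- a + 1 * x"] pos[of "a + (-1) * x"] by linarith
      qed
      then show "norm (indicator {0<..} x * (exp (- l * x) * \<bar>x - a\<bar> powr (-3/4)))
        \<le> norm (indicator {0<..} x * exp (- l * x) + g (- a + 1 * x) + g (a + (-1) * x))"
        using pos[of "- a + 1 * x"] pos[of "a + (-1) * x"]
        by (cases "x > 0") (auto simp: abs_mult)
    qed
  qed measurable
qed

lemma power_exp_integral:
  fixes l :: real
  assumes "l > 0"
  shows "has_bochner_integral lborel (\<lambda>x. indicator {0..} x * (x ^ k * exp (- l * x))) (fact k / l ^ Suc k)"
proof -
  have "has_bochner_integral lborel (\<lambda>x. (0 + l * x) ^ k * exp (- (0 + l * x)) * indicator {0..} (0 + l * x)) (fact k /\<^sub>R \<bar>l\<bar>)"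
    using lborel_has_bochner_integral_real_affine_iff[of l "\<lambda>x. x ^ k * exp (- x) * indicator {0..} x" "fact k" 0]
      has_bochner_integral_I0i_power_exp_m'[of k] assms by simp
  then have "has_bochner_integral lborel (\<lambda>x. inverse (l ^ k) * ((0 + l * x) ^ k * exp (- (0 + l * x)) * indicator {0..} (0 + l * x)))
      (inverse (l ^ k) * (fact k /\<^sub>R \<bar>l\<bar>))"
    by (rule has_bochner_integral_mult_right)
  moreover have "inverse (l ^ k) * ((0 + l * x) ^ k * exp (- (0 + l * x)) * indicator {0..} (0 + l * x))
      = indicator {0..} x * (x ^ k * exp (- l * x))" for x
    using assms by (simp add: power_mult_distrib indicator_def zero_le_mult_iff)
  moreover have "inverse (l ^ k) * (fact k /\<^sub>R \<bar>l\<bar>) = fact k / l ^ Suc k"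
    using assms by (simp add: field_simps)
  ultimately show ?thesis by (simp only:)
qed

lemma odd_power_gauss_integral:
  fixes l :: real
  assumes "l > 0"
  shows "has_bochner_integral lborel (\<lambda>t. indicator {0..} t * (t ^ (2 * k + 1) * exp (- l * t\<^sup>2))) (fact k / (2 * l ^ Suc k))"
proof -
  define c where "c = sqrt l"
  have c: "c > 0" "c\<^sup>2 = l" using assms by (auto simp: c_def)
  have "has_bochner_integral lborel (\<lambda>x. indicator {0..} (0 + c * x) *\<^sub>R (exp (- (0 + c * x)\<^sup>2) * (0 + c * x) ^ (2 * k + 1)))
      ((fact k / 2) /\<^sub>R \<bar>c\<bar>)"
    using lborel_has_bochner_integral_real_affine_iff[of c "\<lambda>x. indicator {0..} x *\<^sub>R (exp (- x\<^sup>2) * x ^ (2 * k + 1))" "fact k / 2" 0]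
      gaussian_moment_odd_pos[of k] c by simp
  then have "has_bochner_integral lborel (\<lambda>x. inverse (c ^ (2 * k + 1)) * (indicator {0..} (0 + c * x) *\<^sub>R (exp (- (0 + c * x)\<^sup>2) * (0 + c * x) ^ (2 * k + 1))))
      (inverse (c ^ (2 * k + 1)) * ((fact k / 2) /\<^sub>R \<bar>c\<bar>))"
    by (rule has_bochner_integral_mult_right)
  moreover have "inverse (c ^ (2 * k + 1)) * (indicator {0..} (0 + c * x) *\<^sub>R (exp (- (0 + c * x)\<^sup>2) * (0 + c * x) ^ (2 * k + 1)))
      = indicator {0..} x * (x ^ (2 * k + 1) * exp (- l * x\<^sup>2))" for x
  proof -
    have "indicator {0..} (c * x) = (indicator {0..} x :: real)" using c by (simp add: indicator_def zero_le_mult_iff)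
    then show ?thesis using c(1) by (simp add: power_mult_distrib c(2) field_simps)
  qed
  moreover have "inverse (c ^ (2 * k + 1)) * ((fact k / 2) /\<^sub>R \<bar>c\<bar>) = fact k / (2 * l ^ Suc k)"
  proof -
    have "c ^ (2 * k + 1) * c = l ^ Suc k" by (simp add: c(2)[symmetric] power2_eq_square power_mult power_mult_distrib)
    then show ?thesis using c(1) by (simp add: field_simps)
  qed
  ultimately show ?thesis by (simp only:)
qed

lemma exp_series_summable: "summable (\<lambda>k. \<bar>y\<bar> ^ k / fact k :: real)"
  using summable_exp[of "\<bar>y\<bar>"] by (simp add: divide_inverse mult.commute)

lemma exp_sums_real: "(\<lambda>k. y ^ k / fact k) sums exp (y :: real)"
  using exp_converges[of y] by (simp add: divide_inverse mult.commute)

text \<open>Termwise integration: the integral of \<open>x ^ k * exp (- l * x)\<close> brings a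
  factor \<open>fact k\<close>, which cancels one of the two in \<open>bessel_coeff\<close> and
  leaves an exponential series. The same computation with absolute values justifies the
  interchange.\<close>

lemma bessel_laplace:
  fixes l s :: real
  assumes l: "l > 0"
  shows "has_bochner_integral lborel (\<lambda>x. indicator {0..} x * (exp (- l * x) * bessel_J0 (s * sqrt x)))
     (exp (- s\<^sup>2 / (4 * l)) / l)"
proof -
  define f where "f k x = bessel_coeff k * (s\<^sup>2 / 4) ^ k * (indicator {0..} x * (x ^ k * exp (- l * x)))" for k x
  have I: "has_bochner_integral lborel (f k) (bessel_coeff k * (s\<^sup>2 / 4) ^ k * (fact k / l ^ Suc k))" for k
    unfolding f_def[abs_def] by (intro has_bochner_integral_mult_right power_exp_integral l)
  have N: "norm (f k x) = \<bar>bessel_coeff k * (s\<^sup>2 / 4) ^ k\<bar> * (indicator {0..} x * (x ^ k * exp (- l * x)))" for k x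
    by (auto simp: f_def abs_mult indicator_def)
  have IN: "(\<integral>x. norm (f k x) \<partial>lborel) = \<bar>bessel_coeff k * (s\<^sup>2 / 4) ^ k\<bar> * (fact k / l ^ Suc k)" for k
    unfolding N by (intro has_bochner_integral_integral_eq has_bochner_integral_mult_right power_exp_integral l)
  have coeff: "bessel_coeff k * (s\<^sup>2 / 4) ^ k * (fact k / l ^ Suc k) = (- s\<^sup>2 / (4 * l)) ^ k / fact k / l" for k
  proof -
    define S where "S = (s\<^sup>2 / 4) ^ k"
    have "- s\<^sup>2 / (4 * l) = (-1) * (s\<^sup>2 / 4) / l" by simp
    then have "(- s\<^sup>2 / (4 * l)) ^ k = (-1) ^ k * S / l ^ k"
      by (simp only: power_mult_distrib power_divide[of _ l] S_def)
    then show ?thesis using l unfolding bessel_coeff_def S_def[symmetric]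
      by (simp add: power2_eq_square)
  qed
  have s1: "AE x in lborel. summable (\<lambda>k. norm (f k x))"
  proof (rule AE_I2)
    fix x :: real
    have "norm (f k x) = indicator {0..} x * exp (- l * x) * \<bar>bessel_coeff k * (s\<^sup>2 / 4 * x) ^ k\<bar>" for k
      by (auto simp: f_def abs_mult power_abs power_mult_distrib power_divide indicator_def)
    then show "summable (\<lambda>k. norm (f k x))"
      by (simp only:) (intro summable_mult summable_abs_bessel)
  qed
  have s2: "summable (\<lambda>k. \<integral>x. norm (f k x) \<partial>lborel)"
  proof -
    have "(\<integral>x. norm (f k x) \<partial>lborel) = \<bar>- s\<^sup>2 / (4 * l)\<bar> ^ k / fact k / l" for k
    proof -
      have "(\<integral>x. norm (f k x) \<partial>lborel) = \<bar>bessel_coeff k * (s\<^sup>2 / 4) ^ k * (fact k / l ^ Suc k)\<bar>"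
        unfolding IN using l by (simp add: abs_mult)
      then show ?thesis unfolding coeff using l by (simp add: power_abs)
    qed
    then show ?thesis by (simp only:) (intro summable_divide exp_series_summable)
  qed
  have sum: "(\<Sum>k. f k x) = indicator {0..} x * (exp (- l * x) * bessel_J0 (s * sqrt x))" for x
  proof (cases "x \<ge> 0")
    case True
    have "f k x = exp (- l * x) * (bessel_coeff k * ((s * sqrt x)\<^sup>2 / 4) ^ k)" for k
      using True by (simp add: f_def power_mult_distrib power_divide)
    then show ?thesis using True
      by (simp only:) (simp add: suminf_mult[OF summable_bessel] bessel_J0_eq bessel_series_def)
  qed (simp add: f_def)
  have int: "integrable lborel (f k)" for k using I[of k] by (simp add: has_bochner_integral_iff)
  have "(\<Sum>k. \<integral>x. f k x \<partial>lborel) = exp (- s\<^sup>2 / (4 * l)) / l"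
  proof -
    have "(\<lambda>k. (- s\<^sup>2 / (4 * l)) ^ k / fact k / l) sums (exp (- s\<^sup>2 / (4 * l)) / l)"
      by (intro sums_divide exp_sums_real)
    then show ?thesis
      unfolding has_bochner_integral_integral_eq[OF I] coeff by (simp add: sums_iff)
  qed
  then show ?thesis
    using integrable_suminf[OF int s1 s2] integral_suminf[OF int s1 s2] unfolding sum
    by (simp add: has_bochner_integral_iff)
qed

text \<open>The Hankel transform of a Gaussian is again a Gaussian. The computation follows
  \<open>bessel_laplace\<close>, with odd Gaussian moments in place of the Gamma integrals; it
  serves to return from the \<open>t\<close> side to the law of
  \<open>squared_modulus\<close>.\<close>

lemma bessel_gauss:
  fixes l s :: real
  assumes l: "l > 0"
  shows "has_bochner_integral lborel (\<lambda>t. indicator {0..} t * (t * exp (- t\<^sup>2 / (4 * l)) * bessel_J0 (t * s)))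
     (2 * l * exp (- l * s\<^sup>2))"
proof -
  define m where "m = 1 / (4 * l)"
  have m: "m > 0" using l by (simp add: m_def)
  define f where "f k t = bessel_coeff k * (s\<^sup>2 / 4) ^ k * (indicator {0..} t * (t ^ (2 * k + 1) * exp (- m * t\<^sup>2)))" for k t
  have I: "has_bochner_integral lborel (f k) (bessel_coeff k * (s\<^sup>2 / 4) ^ k * (fact k / (2 * m ^ Suc k)))" for k
    unfolding f_def[abs_def] by (intro has_bochner_integral_mult_right odd_power_gauss_integral m)
  have N: "norm (f k x) = \<bar>bessel_coeff k * (s\<^sup>2 / 4) ^ k\<bar> * (indicator {0..} x * (x ^ (2 * k + 1) * exp (- m * x\<^sup>2)))" for k x
    by (auto simp: f_def abs_mult indicator_def)
  have IN: "(\<integral>x. norm (f k x) \<partial>lborel) = \<bar>bessel_coeff k * (s\<^sup>2 / 4) ^ k\<bar> * (fact k / (2 * m ^ Suc k))" for k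
    unfolding N by (intro has_bochner_integral_integral_eq has_bochner_integral_mult_right odd_power_gauss_integral m)
  have coeff: "bessel_coeff k * (s\<^sup>2 / 4) ^ k * (fact k / (2 * m ^ Suc k)) = (- l * s\<^sup>2) ^ k / fact k * (2 * l)" for k
  proof -
    define S where "S = (s\<^sup>2 / 4) ^ k"
    have "- l * s\<^sup>2 = (-1) * (s\<^sup>2 / 4) / m" using l by (simp add: m_def)
    then have "(- l * s\<^sup>2) ^ k = (-1) ^ k * S / m ^ k"
      by (simp only: power_mult_distrib power_divide[of _ m] S_def)
    moreover have "2 * l = 1 / (2 * m)" using l by (simp add: m_def)
    ultimately show ?thesis using m unfolding bessel_coeff_def S_def[symmetric]
      by (simp add: power2_eq_square)
  qed
  have s1: "AE x in lborel. summable (\<lambda>k. norm (f k x))"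
  proof (rule AE_I2)
    fix x :: real
    have "norm (f k x) = indicator {0..} x * x * exp (- m * x\<^sup>2) * \<bar>bessel_coeff k * (s\<^sup>2 / 4 * x\<^sup>2) ^ k\<bar>" for k
      by (auto simp: f_def abs_mult power_abs power_mult_distrib power_divide indicator_def power_mult)
    then show "summable (\<lambda>k. norm (f k x))"
      by (simp only:) (intro summable_mult summable_abs_bessel)
  qed
  have s2: "summable (\<lambda>k. \<integral>x. norm (f k x) \<partial>lborel)"
  proof -
    have "(\<integral>x. norm (f k x) \<partial>lborel) = \<bar>- l * s\<^sup>2\<bar> ^ k / fact k * (2 * l)" for k
    proof -
      have "(\<integral>x. norm (f k x) \<partial>lborel) = \<bar>bessel_coeff k * (s\<^sup>2 / 4) ^ k * (fact k / (2 * m ^ Suc k))\<bar>"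
        unfolding IN using m by (simp add: abs_mult)
      then show ?thesis unfolding coeff using l by (simp add: power_abs abs_mult)
    qed
    then show ?thesis by (simp only:) (intro summable_mult2 exp_series_summable)
  qed
  have sum: "(\<Sum>k. f k t) = indicator {0..} t * (t * exp (- t\<^sup>2 / (4 * l)) * bessel_J0 (t * s))" for t
  proof (cases "t \<ge> 0")
    case True
    have "f k t = t * exp (- t\<^sup>2 / (4 * l)) * (bessel_coeff k * ((t * s)\<^sup>2 / 4) ^ k)" for k
      using True by (simp add: f_def m_def power_mult_distrib power_divide power_mult)
    then show ?thesis using True
      by (simp only:) (simp add: suminf_mult[OF summable_bessel] bessel_J0_eq bessel_series_def)
  qed (simp add: f_def)
  have int: "integrable lborel (f k)" for k using I[of k] by (simp add: has_bochner_integral_iff)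
  have "(\<Sum>k. \<integral>x. f k x \<partial>lborel) = 2 * l * exp (- l * s\<^sup>2)"
  proof -
    have "(\<lambda>k. (- l * s\<^sup>2) ^ k / fact k * (2 * l)) sums (exp (- l * s\<^sup>2) * (2 * l))"
      by (intro sums_mult2 exp_sums_real)
    then show ?thesis
      unfolding has_bochner_integral_integral_eq[OF I] coeff by (simp add: sums_iff)
  qed
  then show ?thesis
    using integrable_suminf[OF int s1 s2] integral_suminf[OF int s1 s2] unfolding sum
    by (simp add: has_bochner_integral_iff)
qed

subsection \<open>Averaging over a circle\<close>

lemma integral_cis_int:
  fixes m :: int
  shows "(LBINT z:{-pi..pi}. cis (of_int m * z)) = (if m = 0 then 2 * of_real pi else 0)"
proof (cases "m = 0")
  case True
  then show ?thesis by (simp add: set_lebesgue_integral_def scaleR_conv_of_real)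
next
  case False
  have "((\<lambda>z. cis (of_int m * z)) has_integral
      (cis (of_int m * pi) / (\<i> * of_int m) - cis (of_int m * - pi) / (\<i> * of_int m))) {-pi..pi}"
  proof (rule fundamental_theorem_of_calculus)
    fix x :: real
    have "((\<lambda>z. cis (of_int m * z)) has_vector_derivative (\<i> * of_int m * cis (of_int m * x))) (at x within {-pi..pi})"
      using exp_scaleR_has_vector_derivative_right[of "\<i> * of_int m" x "{-pi..pi}"]
      by (simp add: cis_conv_exp scaleR_conv_of_real mult_ac)
    then show "((\<lambda>z. cis (of_int m * z) / (\<i> * of_int m)) has_vector_derivative cis (of_int m * x)) (at x within {-pi..pi})"
      using False has_vector_derivative_mult_left[of "\<lambda>z. cis (of_int m * z)" "\<i> * of_int m * cis (of_int m * x)" "at x within {-pi..pi}" "1 / (\<i> * of_int m)"]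
      by simp
  qed simp
  moreover have "cis (of_int m * pi) = cis (of_int m * - pi)"
    by (simp add: complex_eq_iff mult.commute[of "of_int m"])
  ultimately have "((\<lambda>z. cis (of_int m * z)) has_integral 0) {-pi..pi}" by simp
  moreover have "set_integrable lborel {-pi..pi} (\<lambda>z. cis (of_int m * z))"
    by (intro borel_integrable_atLeastAtMost' continuous_intros)
  ultimately show ?thesis
    using False set_borel_integral_eq_integral(2) by (metis integral_unique)
qed

lemma set_integrable_continuous_Icc:
  fixes f :: "real \<Rightarrow> 'a :: euclidean_space"
  shows "continuous_on UNIV f \<Longrightarrow> set_integrable lborel {-pi..pi} f"
  by (intro borel_integrable_atLeastAtMost') (auto intro: continuous_on_subset)

lemma set_lebesgue_integral_sum:
  fixes f :: "'i \<Rightarrow> 'a \<Rightarrow> 'b :: {banach, second_countable_topology}"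
  assumes "\<And>i. i \<in> I \<Longrightarrow> set_integrable M A (f i)"
  shows "set_integrable M A (\<lambda>x. \<Sum>i\<in>I. f i x)"
    and "(LINT x:A|M. (\<Sum>i\<in>I. f i x)) = (\<Sum>i\<in>I. LINT x:A|M. f i x)"
  using assms unfolding set_integrable_def set_lebesgue_integral_def scaleR_sum_right
  by (auto intro!: Bochner_Integration.integral_sum)

lemma of_real_norm_power_double: "complex_of_real (norm v ^ (2 * k)) = v ^ k * cnj v ^ k"
proof -
  have "complex_of_real (norm v ^ (2 * k)) = complex_of_real ((norm v)\<^sup>2) ^ k"
    by (simp add: power_mult)
  then show ?thesis by (simp only: complex_norm_square power_mult_distrib)
qed

lemma set_integrable_cis: "set_integrable lborel {-pi..pi} (\<lambda>z. c * cis (of_int m * z))"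
  by (intro set_integrable_continuous_Icc continuous_intros)

text \<open>Binomial expansion of \<open>v ^ k * cnj v ^ k\<close>. Only the frequencies
  \<open>j - i\<close> with \<open>i, j \<le> k\<close> occur. The constant term gives the circle
  means, and the degree bound \<open>k\<close> kills the high Fourier coefficients.\<close>

lemma norm_add_cis_power_expand:
  "complex_of_real (norm (w + cis z) ^ (2 * k)) =
      (\<Sum>i\<le>k. \<Sum>j\<le>k. (of_nat (k choose i) * of_nat (k choose j) * w ^ i * cnj w ^ j) * cis (of_int (int j - int i) * z))"
proof -
  have "complex_of_real (norm (w + cis z) ^ (2 * k)) = (w + cis z) ^ k * (cnj (w + cis z)) ^ k"
    by (rule of_real_norm_power_double)
  also have "\<dots> = (\<Sum>i\<le>k. of_nat (k choose i) * w ^ i * cis z ^ (k - i)) * (\<Sum>j\<le>k. of_nat (k choose j) * cnj w ^ j * cis (- z) ^ (k - j))"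
    by (simp add: binomial_ring cis_cnj)
  also have "\<dots> = (\<Sum>i\<le>k. \<Sum>j\<le>k. (of_nat (k choose i) * of_nat (k choose j) * w ^ i * cnj w ^ j) * cis (of_int (int j - int i) * z))"
    unfolding sum_product
  proof (intro sum.cong refl)
    fix i j assume "i \<in> {..k}" "j \<in> {..k}"
    then have "real (k - i) * z + real (k - j) * (- z) = of_int (int j - int i) * z"
      by (simp add: of_nat_diff algebra_simps)
    then have "cis z ^ (k - i) * cis (- z) ^ (k - j) = cis (of_int (int j - int i) * z)"
      by (simp only: Complex.DeMoivre cis_mult)
    then show "of_nat (k choose i) * w ^ i * cis z ^ (k - i) * (of_nat (k choose j) * cnj w ^ j * cis (- z) ^ (k - j))
      = (of_nat (k choose i) * of_nat (k choose j) * w ^ i * cnj w ^ j) * cis (of_int (int j - int i) * z)"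
      by (metis (no_types, opaque_lifting) mult.assoc mult.left_commute)
  qed
  finally show ?thesis .
qed

lemma mean_power_norm_circle:
  fixes w :: complex
  shows "(LBINT z:{-pi..pi}. norm (w + cis z) ^ (2 * k))
     = 2 * pi * (\<Sum>j\<le>k. (real (k choose j))\<^sup>2 * norm w ^ (2 * j))"
proof -
  have "complex_of_real (LBINT z:{-pi..pi}. norm (w + cis z) ^ (2 * k))
      = (LBINT z:{-pi..pi}. complex_of_real (norm (w + cis z) ^ (2 * k)))"
    by (rule set_integral_complex_of_real[symmetric])
  also have "\<dots> = (\<Sum>i\<le>k. \<Sum>j\<le>k. LBINT z:{-pi..pi}. (of_nat (k choose i) * of_nat (k choose j) * w ^ i * cnj w ^ j) * cis (of_int (int j - int i) * z))"
    unfolding norm_add_cis_power_expand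
    by (simp only: set_lebesgue_integral_sum set_integrable_cis)
  also have "\<dots> = (\<Sum>i\<le>k. \<Sum>j\<le>k. if i = j then (of_nat (k choose i) * of_nat (k choose j) * w ^ i * cnj w ^ j) * (2 * of_real pi) else 0)"
    by (intro sum.cong refl, simp only: set_integral_mult_right integral_cis_int) auto
  also have "\<dots> = (\<Sum>i\<le>k. (of_nat (k choose i) * of_nat (k choose i) * w ^ i * cnj w ^ i) * (2 * of_real pi))"
    by (simp add: sum.delta)
  also have "\<dots> = complex_of_real (2 * pi * (\<Sum>j\<le>k. (real (k choose j))\<^sup>2 * norm w ^ (2 * j)))"
  proof -
    have "(of_nat b * of_nat b * w ^ i * cnj w ^ i) * (2 * of_real pi)
        = complex_of_real (2 * pi * ((real b)\<^sup>2 * norm w ^ (2 * i)))" for i b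
    proof -
      have "(of_nat b * of_nat b * w ^ i * cnj w ^ i) * (2 * of_real pi)
          = of_nat b * of_nat b * complex_of_real (norm w ^ (2 * i)) * (2 * of_real pi)"
        unfolding of_real_norm_power_double by (simp only: mult.assoc)
      then show ?thesis by (simp add: power2_eq_square)
    qed
    then show ?thesis by (simp only: of_real_sum sum_distrib_left)
  qed
  finally show ?thesis by (simp only: of_real_eq_iff)
qed

lemma norm_add_cis_power_fourier_zero:
  fixes w :: complex and m :: int
  assumes "\<bar>m\<bar> > int k"
  shows "(LBINT z:{-pi..pi}. complex_of_real (norm (w + cis z) ^ (2 * k)) * cis (of_int m * z)) = 0"
proof -
  have mult: "c * cis (of_int a * z) * cis (of_int b * z) = c * cis (of_int (a + b) * z)" for c a b z
    by (simp add: cis_mult distrib_right mult.assoc)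
  have "(LBINT z:{-pi..pi}. complex_of_real (norm (w + cis z) ^ (2 * k)) * cis (of_int m * z))
     = (\<Sum>i\<le>k. \<Sum>j\<le>k. LBINT z:{-pi..pi}.
          (of_nat (k choose i) * of_nat (k choose j) * w ^ i * cnj w ^ j) * cis (of_int (int j - int i + m) * z))"
    unfolding norm_add_cis_power_expand sum_distrib_right mult
    by (simp only: set_lebesgue_integral_sum set_integrable_cis)
  also have "\<dots> = 0"
  proof (intro sum.neutral ballI)
    fix i j assume "i \<in> {..k}" "j \<in> {..k}"
    then have "int j - int i + m \<noteq> 0" using assms by auto
    then show "(LBINT z:{-pi..pi}.
          (of_nat (k choose i) * of_nat (k choose j) * w ^ i * cnj w ^ j) * cis (of_int (int j - int i + m) * z)) = 0"
      by (simp only: set_integral_mult_right integral_cis_int) simp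
  qed
  finally show ?thesis .
qed

lemma norm_add_cis_le: "norm (w + cis z) \<le> norm w + 1"
  using norm_triangle_ineq[of w "cis z"] by simp

text \<open>After termwise integration, the squared binomials in
  \<open>mean_power_norm_circle\<close> are exactly those that turn the series into the Cauchy
  product of the two Bessel series.\<close>

lemma bessel_mean_circle:
  fixes w :: complex and t :: real
  shows "(LBINT z:{-pi..pi}. bessel_J0 (t * norm (w + cis z))) = 2 * pi * (bessel_J0 (t * norm w) * bessel_J0 t)"
proof -
  define y where "y = t\<^sup>2 / 4"
  define f where "f k z = indicator {-pi..pi} z * (bessel_coeff k * y ^ k * norm (w + cis z) ^ (2 * k))" for k z
  define B where "B k = \<bar>bessel_coeff k * (y * (norm w + 1)\<^sup>2) ^ k\<bar>" for k
  have y: "y \<ge> 0" by (simp add: y_def)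
  have fB: "norm (f k z) \<le> indicator {-pi..pi} z * B k" for k z
  proof -
    have "\<bar>norm (w + cis z) ^ (2 * k)\<bar> \<le> (norm w + 1) ^ (2 * k)"
      by (simp add: power_mono norm_add_cis_le)
    then have "\<bar>bessel_coeff k * y ^ k\<bar> * \<bar>norm (w + cis z) ^ (2 * k)\<bar> \<le> \<bar>bessel_coeff k * y ^ k\<bar> * (norm w + 1) ^ (2 * k)"
      by (rule mult_left_mono) simp
    also have "\<dots> = B k" by (simp add: B_def abs_mult power_abs power_mult_distrib power_mult)
    finally show ?thesis by (auto simp: f_def indicator_def abs_mult)
  qed
  have "summable B" unfolding B_def by (rule summable_abs_bessel)
  have int: "integrable lborel (f k)" for k
  proof -
    have "set_integrable lborel {-pi..pi} (\<lambda>z. bessel_coeff k * y ^ k * norm (w + cis z) ^ (2 * k))"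
      by (intro set_integrable_continuous_Icc continuous_intros)
    then show ?thesis by (simp add: f_def[abs_def] set_integrable_def)
  qed
  have s1: "AE z in lborel. summable (\<lambda>k. norm (f k z))"
    by (intro AE_I2 summable_comparison_test'[OF summable_mult[OF \<open>summable B\<close>]])
       (use fB in simp)
  have s2: "summable (\<lambda>k. \<integral>z. norm (f k z) \<partial>lborel)"
  proof (rule summable_comparison_test'[OF summable_mult[OF \<open>summable B\<close>, of "2 * pi"]])
    fix k
    have "(\<integral>z. norm (f k z) \<partial>lborel) \<le> (\<integral>z. indicator {-pi..pi} z * B k \<partial>lborel)"
      by (intro integral_mono integrable_norm int fB) (simp add: integrable_real_indicator)
    then show "norm (\<integral>z. norm (f k z) \<partial>lborel) \<le> 2 * pi * B k" by simp
  qed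
  have sum: "(\<Sum>k. f k z) = indicator {-pi..pi} z * bessel_J0 (t * norm (w + cis z))" for z
  proof -
    have "f k z = indicator {-pi..pi} z * (bessel_coeff k * ((t * norm (w + cis z))\<^sup>2 / 4) ^ k)" for k
      by (simp add: f_def y_def power_mult_distrib power_divide power_mult)
    then show ?thesis
      by (simp only:) (simp add: suminf_mult[OF summable_bessel] bessel_J0_eq bessel_series_def)
  qed
  have "(LBINT z:{-pi..pi}. bessel_J0 (t * norm (w + cis z))) = (\<Sum>k. \<integral>z. f k z \<partial>lborel)"
    using integral_suminf[OF int s1 s2] unfolding sum by (simp add: set_lebesgue_integral_def)
  also have "\<dots> = (\<Sum>k. 2 * pi * (\<Sum>j\<le>k. (bessel_coeff j * ((t * norm w)\<^sup>2 / 4) ^ j) * (bessel_coeff (k - j) * (t\<^sup>2 / 4) ^ (k - j))))"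
  proof (rule arg_cong[where f = suminf], rule ext)
    fix k
    have "(\<integral>z. f k z \<partial>lborel) = bessel_coeff k * y ^ k * (LBINT z:{-pi..pi}. norm (w + cis z) ^ (2 * k))"
      by (simp add: f_def set_lebesgue_integral_def mult_ac flip: integral_mult_right_zero)
    also have "\<dots> = 2 * pi * (\<Sum>j\<le>k. bessel_coeff k * y ^ k * ((real (k choose j))\<^sup>2 * norm w ^ (2 * j)))"
      unfolding mean_power_norm_circle by (simp add: sum_distrib_left mult_ac)
    also have "(\<Sum>j\<le>k. bessel_coeff k * y ^ k * ((real (k choose j))\<^sup>2 * norm w ^ (2 * j)))
       = (\<Sum>j\<le>k. (bessel_coeff j * ((t * norm w)\<^sup>2 / 4) ^ j) * (bessel_coeff (k - j) * (t\<^sup>2 / 4) ^ (k - j)))"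
    proof (rule sum.cong[OF refl])
      fix j assume "j \<in> {..k}"
      then have j: "j \<le> k" by simp
      \<comment> \<open>The factor \<open>(fact k)^2\<close> of the squared binomial cancels the
        denominator of \<open>bessel_coeff k\<close>, and the sign splits along
        \<open>k = j + (k - j)\<close>.\<close>
      have b: "bessel_coeff k * (real (k choose j))\<^sup>2 = bessel_coeff j * bessel_coeff (k - j)"
      proof -
        have "(-1) ^ k = (-1 :: real) ^ j * (-1) ^ (k - j)" using j by (simp flip: power_add)
        then show ?thesis using j
          by (simp add: bessel_coeff_def binomial_fact power_divide power_mult_distrib)
      qed
      have p: "y ^ k = y ^ j * y ^ (k - j)" using j by (simp flip: power_add)
      have "bessel_coeff k * y ^ k * ((real (k choose j))\<^sup>2 * norm w ^ (2 * j))
          = (bessel_coeff k * (real (k choose j))\<^sup>2) * (y * (norm w)\<^sup>2) ^ j * y ^ (k - j)"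
        unfolding p by (simp add: power_mult_distrib power_mult)
      then show "bessel_coeff k * y ^ k * ((real (k choose j))\<^sup>2 * norm w ^ (2 * j))
          = (bessel_coeff j * ((t * norm w)\<^sup>2 / 4) ^ j) * (bessel_coeff (k - j) * (t\<^sup>2 / 4) ^ (k - j))"
        unfolding b by (simp add: y_def power_mult_distrib mult_ac)
    qed
    finally show "(\<integral>z. f k z \<partial>lborel) = 2 * pi * (\<Sum>j\<le>k. (bessel_coeff j * ((t * norm w)\<^sup>2 / 4) ^ j) * (bessel_coeff (k - j) * (t\<^sup>2 / 4) ^ (k - j)))" .
  qed
  also have "\<dots> = 2 * pi * (bessel_J0 (t * norm w) * bessel_J0 t)"
  proof -
    have "(\<lambda>k. \<Sum>j\<le>k. (bessel_coeff j * ((t * norm w)\<^sup>2 / 4) ^ j) * (bessel_coeff (k - j) * (t\<^sup>2 / 4) ^ (k - j)))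
        sums (bessel_J0 (t * norm w) * bessel_J0 t)"
      unfolding bessel_J0_eq bessel_series_def
      by (rule Cauchy_product_sums) (simp_all only: real_norm_def summable_abs_bessel)
    then have "(\<lambda>k. 2 * pi * (\<Sum>j\<le>k. (bessel_coeff j * ((t * norm w)\<^sup>2 / 4) ^ j) * (bessel_coeff (k - j) * (t\<^sup>2 / 4) ^ (k - j))))
        sums (2 * pi * (bessel_J0 (t * norm w) * bessel_J0 t))"
      by (rule sums_mult)
    then show ?thesis by (rule sums_unique[symmetric])
  qed
  finally show ?thesis .
qed

subsection \<open>The random walk on the torus\<close>

definition circle_measure :: "real measure" where
  "circle_measure = density lborel (\<lambda>x. ennreal (indicator {-pi..pi} x / (2 * pi)))"

definition torus_measure :: "(real \<times> real \<times> real) measure" where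
  "torus_measure = circle_measure \<Otimes>\<^sub>M (circle_measure \<Otimes>\<^sub>M circle_measure)"

definition squared_modulus :: "real \<times> real \<times> real \<Rightarrow> real" where
  "squared_modulus \<omega> = (case \<omega> of (x, y, z) \<Rightarrow> (norm (cis x + cis y + cis z))\<^sup>2)"

lemma sets_circle_measure [measurable_cong, simp]: "sets circle_measure = sets borel"
  by (simp add: circle_measure_def)

lemma borel_measurable_cis [measurable]: "cis \<in> borel_measurable borel"
  by (intro borel_measurable_continuous_onI continuous_intros)

lemma integral_circle_measure:
  fixes f :: "real \<Rightarrow> real"
  assumes [measurable]: "f \<in> borel_measurable borel"
  shows "(\<integral>x. f x \<partial>circle_measure) = (LBINT x:{-pi..pi}. f x) / (2 * pi)"
  unfolding circle_measure_def
  by (subst integral_density) (simp_all add: set_lebesgue_integral_def flip: integral_divide_zero)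

lemma prob_space_circle_measure: "prob_space circle_measure"
proof
  have "emeasure circle_measure (space circle_measure) = (\<integral>\<^sup>+x. ennreal (indicator {-pi..pi} x / (2 * pi)) \<partial>lborel)"
    by (simp add: circle_measure_def emeasure_density)
  also have "\<dots> = (\<integral>\<^sup>+x. ennreal (1 / (2 * pi)) * indicator {-pi..pi} x \<partial>lborel)"
    by (intro nn_integral_cong) (auto simp: indicator_def)
  also have "\<dots> = ennreal (1 / (2 * pi)) * ennreal (2 * pi)"
    by (subst nn_integral_cmult_indicator) auto
  also have "\<dots> = 1" by (simp flip: ennreal_mult)
  finally show "emeasure circle_measure (space circle_measure) = 1" .
qed

interpretation circle: prob_space circle_measure by (rule prob_space_circle_measure)
interpretation circle2: pair_prob_space circle_measure circle_measure ..
interpretation torus: pair_prob_space circle_measure "circle_measure \<Otimes>\<^sub>M circle_measure" ..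

lemma prob_space_torus_measure: "prob_space torus_measure"
  unfolding torus_measure_def by (rule torus.prob_space_axioms)

lemma sets_torus_measure [measurable_cong]: "sets torus_measure = sets (borel \<Otimes>\<^sub>M (borel \<Otimes>\<^sub>M borel))"
  unfolding torus_measure_def by (intro sets_pair_measure_cong sets_circle_measure)

lemma integral_torus_measure:
  fixes f :: "real \<times> real \<times> real \<Rightarrow> real"
  assumes [measurable]: "f \<in> borel_measurable (borel \<Otimes>\<^sub>M (borel \<Otimes>\<^sub>M borel))" and B: "\<And>\<omega>. \<bar>f \<omega>\<bar> \<le> B"
  shows "(\<integral>\<omega>. f \<omega> \<partial>torus_measure) = (\<integral>x. \<integral>y. \<integral>z. f (x, y, z) \<partial>circle_measure \<partial>circle_measure \<partial>circle_measure)"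
proof -
  have "(\<integral>\<omega>. f \<omega> \<partial>torus_measure) = (\<integral>x. \<integral>w. f (x, w) \<partial>(circle_measure \<Otimes>\<^sub>M circle_measure) \<partial>circle_measure)"
    unfolding torus_measure_def
    by (intro torus.integral_fst'[symmetric] torus.P.integrable_const_bound[where B = B]) (use B in auto)
  also have "\<dots> = (\<integral>x. \<integral>y. \<integral>z. f (x, y, z) \<partial>circle_measure \<partial>circle_measure \<partial>circle_measure)"
    by (intro Bochner_Integration.integral_cong refl circle2.integral_fst'[of "\<lambda>w. f (x, w)" for x, symmetric]
         circle2.P.integrable_const_bound[where B = B]) (use B in auto)
  finally show ?thesis .
qed

lemma squared_modulus_measurable [measurable]:
  "squared_modulus \<in> borel_measurable (borel \<Otimes>\<^sub>M (borel \<Otimes>\<^sub>M borel))"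
  unfolding squared_modulus_def[abs_def] by measurable

lemma squared_modulus_bounds: "0 \<le> squared_modulus \<omega>" "squared_modulus \<omega> \<le> 9"
proof -
  obtain x y z where [simp]: "\<omega> = (x, y, z)" by (cases \<omega>)
  have "norm (cis x + cis y + cis z) \<le> 3"
    by (rule order_trans[OF norm_triangle_ineq]) (use norm_triangle_ineq[of "cis x" "cis y"] in simp)
  then have "(norm (cis x + cis y + cis z))\<^sup>2 \<le> 3\<^sup>2" by (intro power_mono) auto
  then show "0 \<le> squared_modulus \<omega>" "squared_modulus \<omega> \<le> 9"
    by (auto simp: squared_modulus_def)
qed

lemma bessel_J0_bounded: "\<exists>C\<ge>0. \<forall>t\<ge>0. \<bar>bessel_J0 t\<bar> \<le> C"
proof -
  obtain C where "\<And>t. t \<ge> 0 \<Longrightarrow> \<bar>bessel_J0 t\<bar> \<le> C" by (rule bessel_J0_asymptotics) blast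
  moreover from this[of 0] have "C \<ge> 0" by auto
  ultimately show ?thesis by blast
qed

text \<open>\<open>bessel_mean_circle\<close> is used first with \<open>w = cis x + cis y\<close>,
  then with \<open>w = cis x\<close>; since \<open>cis x\<close> has norm 1, the remaining value
  supplies the third factor.\<close>

lemma bessel_mean_torus:
  assumes t: "t \<ge> 0"
  shows "(\<integral>\<omega>. bessel_J0 (t * sqrt (squared_modulus \<omega>)) \<partial>torus_measure) = bessel_J0 t ^ 3"
proof -
  obtain C where C: "\<And>t. t \<ge> 0 \<Longrightarrow> \<bar>bessel_J0 t\<bar> \<le> C" using bessel_J0_bounded by blast
  have mean: "(\<integral>z. bessel_J0 (t * norm (w + cis z)) \<partial>circle_measure) = bessel_J0 (t * norm w) * bessel_J0 t" for w
    by (subst integral_circle_measure) (simp_all add: bessel_mean_circle)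
  have "(\<integral>\<omega>. bessel_J0 (t * sqrt (squared_modulus \<omega>)) \<partial>torus_measure)
     = (\<integral>x. \<integral>y. \<integral>z. bessel_J0 (t * norm (cis x + cis y + cis z)) \<partial>circle_measure \<partial>circle_measure \<partial>circle_measure)"
    using C t squared_modulus_bounds by (subst integral_torus_measure[where B = C]) (auto simp: squared_modulus_def)
  also have "\<dots> = (\<integral>x. bessel_J0 (t * norm (cis x)) * bessel_J0 t * bessel_J0 t \<partial>circle_measure)"
    by (simp only: mean Bochner_Integration.integral_mult_left_zero)
  also have "\<dots> = bessel_J0 t ^ 3" by (simp add: power3_eq_cube circle.prob_space)
  finally show ?thesis .
qed

lemma nanotube_moment_eq_torus:
  assumes "k < p + q"
  shows "nanotube_moment p q k = of_real (\<integral>\<omega>. squared_modulus \<omega> ^ k \<partial>torus_measure)"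
proof -
  define I where "I j = (LBINT x:{-pi..pi}. LBINT y:{-pi..pi}. LBINT z:{-pi..pi}.
          of_real (norm (cis x + cis y + cis z) ^ (2 * k)) *
          cis (of_int j * (of_nat p * (x - z) + of_nat q * (y - z))))" for j :: int
  have I0: "I j = 0" if "j \<noteq> 0" for j
  proof -
    \<comment> \<open>This is the total frequency of the exponential in \<open>z\<close>. For
      \<open>j \<noteq> 0\<close> it is at least \<open>p + q > k\<close> in absolute value, so the
      innermost integral already vanishes for fixed \<open>x\<close> and \<open>y\<close>.\<close>
    define m where "m = - (j * int (p + q))"
    have "int k < \<bar>j\<bar> * int (p + q)"
    proof -
      have "1 * int (p + q) \<le> \<bar>j\<bar> * int (p + q)" using that by (intro mult_right_mono) auto
      moreover have "int k < 1 * int (p + q)" using assms by simp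
      ultimately show ?thesis by (rule less_le_trans[rotated])
    qed
    then have m: "\<bar>m\<bar> > int k" by (simp add: m_def abs_mult)
    have "(LBINT z:{-pi..pi}. complex_of_real (norm (cis x + cis y + cis z) ^ (2 * k)) *
          cis (of_int j * (of_nat p * (x - z) + of_nat q * (y - z)))) = 0" for x y
    proof -
      have "cis (of_int j * (of_nat p * (x - z) + of_nat q * (y - z)))
          = cis (of_int m * z) * cis (of_int j * (of_nat p * x + of_nat q * y))" for z
        unfolding cis_mult by (rule arg_cong[where f = cis]) (simp add: m_def algebra_simps)
      then have "(LBINT z:{-pi..pi}. complex_of_real (norm (cis x + cis y + cis z) ^ (2 * k)) *
          cis (of_int j * (of_nat p * (x - z) + of_nat q * (y - z))))
         = (LBINT z:{-pi..pi}. (complex_of_real (norm (cis x + cis y + cis z) ^ (2 * k)) * cis (of_int m * z)))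
            * cis (of_int j * (of_nat p * x + of_nat q * y))"
        by (simp only: mult.assoc[symmetric] set_integral_mult_left)
      then show ?thesis by (simp only: norm_add_cis_power_fourier_zero[OF m] mult_zero_left)
    qed
    then show ?thesis unfolding I_def by (simp only: set_lebesgue_integral_zero)
  qed
  have "(\<Sum>\<^sub>\<infinity>j\<in>UNIV. I j) = (\<Sum>\<^sub>\<infinity>j\<in>{0}. I j)"
    by (rule infsum_cong_neutral) (auto simp: I0)
  also have "\<dots> = I 0" by simp
  also have "\<dots> = of_real (LBINT x:{-pi..pi}. LBINT y:{-pi..pi}. LBINT z:{-pi..pi}. norm (cis x + cis y + cis z) ^ (2 * k))"
    unfolding I_def by (simp only: of_int_0 mult_zero_left cis_zero mult_1_right set_integral_complex_of_real)
  also have "(LBINT x:{-pi..pi}. LBINT y:{-pi..pi}. LBINT z:{-pi..pi}. norm (cis x + cis y + cis z) ^ (2 * k))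
     = (2 * pi) ^ 3 * (\<integral>\<omega>. squared_modulus \<omega> ^ k \<partial>torus_measure)"
  proof -
    have "(\<integral>\<omega>. squared_modulus \<omega> ^ k \<partial>torus_measure)
       = (\<integral>x. \<integral>y. \<integral>z. norm (cis x + cis y + cis z) ^ (2 * k) \<partial>circle_measure \<partial>circle_measure \<partial>circle_measure)"
      using squared_modulus_bounds
      by (subst integral_torus_measure[where B = "9 ^ k"]) (auto simp: squared_modulus_def power_mult intro!: power_mono)
    also have "\<dots> = (LBINT x:{-pi..pi}. LBINT y:{-pi..pi}. LBINT z:{-pi..pi}. norm (cis x + cis y + cis z) ^ (2 * k)) / (2 * pi) / (2 * pi) / (2 * pi)"
      by (subst integral_circle_measure integral_circle_measure[where f = "\<lambda>z. norm (cis x + cis y + cis z) ^ (2 * k)" for x y], measurable)+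
    finally show ?thesis by (simp add: power3_eq_cube)
  qed
  finally have "(\<Sum>\<^sub>\<infinity>j\<in>UNIV. I j) = (2 * of_real pi) ^ 3 * of_real (\<integral>\<omega>. squared_modulus \<omega> ^ k \<partial>torus_measure)"
    by simp
  then show ?thesis unfolding nanotube_moment_def I_def[symmetric] by simp
qed

subsection \<open>Laplace transform of the triangular density\<close>

text \<open>This provides the hypothesis of Fubini's theorem in the two interchanges with Bessel
  integrands below.\<close>

lemma (in pair_sigma_finite) integrable_product_bound:
  fixes f :: "'a \<times> 'b \<Rightarrow> real" and a :: "'a \<Rightarrow> real" and b :: "'b \<Rightarrow> real"
  assumes f: "f \<in> borel_measurable (M1 \<Otimes>\<^sub>M M2)" and a: "integrable M1 a" and b: "integrable M2 b"
    and le: "\<And>x y. \<bar>f (x, y)\<bar> \<le> a x * b y"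
  shows "integrable (M1 \<Otimes>\<^sub>M M2) f"
proof (rule Bochner_Integration.integrable_bound[OF _ f])
  have [measurable]: "a \<in> borel_measurable M1" "b \<in> borel_measurable M2" using a b by auto
  show "integrable (M1 \<Otimes>\<^sub>M M2) (\<lambda>(x, y). a x * b y)"
  proof (rule Fubini_integrable)
    have "(\<integral>y. norm (case (x, y) of (x, y) \<Rightarrow> a x * b y) \<partial>M2) = \<bar>a x\<bar> * (\<integral>y. \<bar>b y\<bar> \<partial>M2)" for x
      by (simp add: abs_mult)
    then show "integrable M1 (\<lambda>x. \<integral>y. norm (case (x, y) of (x, y) \<Rightarrow> a x * b y) \<partial>M2)"
      using a by simp
    show "AE x in M1. integrable M2 (\<lambda>y. case (x, y) of (x, y) \<Rightarrow> a x * b y)"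
      using b by simp
  qed measurable
  show "AE w in M1 \<Otimes>\<^sub>M M2. norm (f w) \<le> norm (case w of (x, y) \<Rightarrow> a x * b y)"
    using le by (intro AE_I2) (auto intro: order_trans[OF le] simp: split_beta)
qed

lemma bessel_laplace_pos:
  fixes l s :: real
  assumes l: "l > 0"
  shows "(\<integral>x. indicator {0<..} x * (exp (- l * x) * bessel_J0 (s * sqrt x)) \<partial>lborel) = exp (- s\<^sup>2 / (4 * l)) / l"
proof -
  have "(\<integral>x. indicator {0<..} x * (exp (- l * x) * bessel_J0 (s * sqrt x)) \<partial>lborel)
     = (\<integral>x. indicator {0..} x * (exp (- l * x) * bessel_J0 (s * sqrt x)) \<partial>lborel)"
  proof (rule integral_cong_AE)
    show "AE x in lborel. indicator {0<..} x * (exp (- l * x) * bessel_J0 (s * sqrt x))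
        = indicator {0..} x * (exp (- l * x) * bessel_J0 (s * sqrt x))"
      using AE_lborel_singleton[of 0] by eventually_elim (auto simp: indicator_def)
  qed measurable
  then show ?thesis using bessel_laplace[OF l, of s] by (simp add: has_bochner_integral_iff)
qed

text \<open>The truncation makes Fubini's theorem applicable: for \<open>t\<close> in
  \<open>{0..R}\<close> the integrand is at most \<open>R * C ^ 4\<close> times the exponential. The
  inner integral over \<open>x\<close> is then \<open>bessel_laplace_pos\<close>.\<close>

lemma laplace_bessel_partial:
  assumes l: "l > 0" and R: "R \<ge> 0"
  shows "(\<integral>x. indicator {0<..} x * (exp (- l * x) * bessel_partial R x) \<partial>lborel)
     = (\<integral>t. indicator {0..R} t * (t * exp (- t\<^sup>2 / (4 * l)) * bessel_J0 t ^ 3) \<partial>lborel) / l"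
proof -
  obtain C where C: "C \<ge> 0" "\<And>t. t \<ge> 0 \<Longrightarrow> \<bar>bessel_J0 t\<bar> \<le> C" using bessel_J0_bounded by blast
  define g where "g x t = indicator {0<..} x * exp (- l * x) *
     (indicator {0..R} t * (t * bessel_J0 (t * sqrt x) * bessel_J0 t ^ 3))" for x t :: real
  have [measurable]: "(\<lambda>(x, t). g x t) \<in> borel_measurable (lborel \<Otimes>\<^sub>M lborel)"
    unfolding g_def by measurable
  have e: "integrable lborel (\<lambda>x. indicator {0<..} x * exp (- l * x))"
    using integrable_I0i_exp_mscale[OF l] by (simp add: set_integrable_def mult.commute)
  have int: "integrable (lborel \<Otimes>\<^sub>M lborel) (\<lambda>(x, t). g x t)"
  proof (rule lborel_pair.integrable_product_bound[OF _ e])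
    show "integrable lborel (\<lambda>t. indicator {0..R} t * (R * C ^ 4))" using R by simp
    fix x t :: real
    have "\<bar>t\<bar> * \<bar>bessel_J0 (t * sqrt x)\<bar> * \<bar>bessel_J0 t\<bar> ^ 3 \<le> R * C * C ^ 3" if "x > 0" "t \<in> {0..R}"
      using that C by (intro mult_mono power_mono) auto
    then have "\<bar>t * bessel_J0 (t * sqrt x) * bessel_J0 t ^ 3\<bar> \<le> R * C ^ 4" if "x > 0" "t \<in> {0..R}"
      using that by (simp add: abs_mult power_abs mult.assoc flip: power_Suc)
    then show "\<bar>case (x, t) of (x, t) \<Rightarrow> g x t\<bar> \<le> indicator {0<..} x * exp (- l * x) * (indicator {0..R} t * (R * C ^ 4))"
      by (auto simp: g_def indicator_def abs_mult)
  qed measurable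
  have "(\<integral>x. indicator {0<..} x * (exp (- l * x) * bessel_partial R x) \<partial>lborel) = (\<integral>x. \<integral>t. g x t \<partial>lborel \<partial>lborel)"
    unfolding bessel_partial_def set_lebesgue_integral_def g_def by (simp add: mult.assoc)
  also have "\<dots> = (\<integral>t. \<integral>x. g x t \<partial>lborel \<partial>lborel)"
    by (rule lborel_pair.Fubini_integral[OF int, symmetric])
  also have "\<dots> = (\<integral>t. indicator {0..R} t * (t * bessel_J0 t ^ 3) * (exp (- t\<^sup>2 / (4 * l)) / l) \<partial>lborel)"
  proof (rule Bochner_Integration.integral_cong[OF refl])
    fix t :: real
    have "(\<integral>x. g x t \<partial>lborel) = (\<integral>x. indicator {0..R} t * (t * bessel_J0 t ^ 3) *
        (indicator {0<..} x * (exp (- l * x) * bessel_J0 (t * sqrt x))) \<partial>lborel)"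
      unfolding g_def by (intro Bochner_Integration.integral_cong refl) (simp add: mult_ac)
    then show "(\<integral>x. g x t \<partial>lborel) = indicator {0..R} t * (t * bessel_J0 t ^ 3) * (exp (- t\<^sup>2 / (4 * l)) / l)"
      by (simp only: Bochner_Integration.integral_mult_right_zero bessel_laplace_pos[OF l])
  qed
  also have "\<dots> = (\<integral>t. indicator {0..R} t * (t * exp (- t\<^sup>2 / (4 * l)) * bessel_J0 t ^ 3) \<partial>lborel) / l"
    unfolding Bochner_Integration.integral_divide_zero[symmetric]
    by (intro Bochner_Integration.integral_cong refl) simp
  finally show ?thesis .
qed

text \<open>The cube is rewritten as a torus mean by \<open>bessel_mean_torus\<close>; the Gaussian
  permits exchanging the integrals, and \<open>bessel_gauss\<close> evaluates the inner one.\<close>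

lemma gauss_bessel_cube:
  assumes l: "l > 0"
  shows "(\<integral>t. indicator {0..} t * (t * exp (- t\<^sup>2 / (4 * l)) * bessel_J0 t ^ 3) \<partial>lborel)
     = 2 * l * (\<integral>\<omega>. exp (- l * squared_modulus \<omega>) \<partial>torus_measure)"
proof -
  obtain C where C: "C \<ge> 0" "\<And>t. t \<ge> 0 \<Longrightarrow> \<bar>bessel_J0 t\<bar> \<le> C" using bessel_J0_bounded by blast
  interpret T: prob_space torus_measure by (rule prob_space_torus_measure)
  interpret TL: pair_sigma_finite torus_measure lborel ..
  define g where "g \<omega> t = indicator {0..} t * (t * exp (- t\<^sup>2 / (4 * l)) * bessel_J0 (t * sqrt (squared_modulus \<omega>)))" for \<omega> t
  have [measurable]: "(\<lambda>(\<omega>, t). g \<omega> t) \<in> borel_measurable (torus_measure \<Otimes>\<^sub>M lborel)"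
    unfolding g_def by measurable
  have e: "integrable lborel (\<lambda>t. indicator {0..} t * (t * exp (- t\<^sup>2 / (4 * l))))"
    using odd_power_gauss_integral[of "1 / (4 * l)" 0] l by (simp add: has_bochner_integral_iff)
  have int: "integrable (torus_measure \<Otimes>\<^sub>M lborel) (\<lambda>(\<omega>, t). g \<omega> t)"
  proof (rule TL.integrable_product_bound)
    show "integrable torus_measure (\<lambda>\<omega>. C)" by simp
    fix \<omega> t
    show "\<bar>case (\<omega>, t) of (\<omega>, t) \<Rightarrow> g \<omega> t\<bar> \<le> C * (indicator {0..} t * (t * exp (- t\<^sup>2 / (4 * l))))"
      using mult_left_mono[OF C(2)[of "t * sqrt (squared_modulus \<omega>)"], of "t * exp (- t\<^sup>2 / (4 * l))"] squared_modulus_bounds[of \<omega>]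
      by (auto simp: g_def indicator_def abs_mult mult_ac)
  qed (use e in measurable)
  have "(\<integral>t. indicator {0..} t * (t * exp (- t\<^sup>2 / (4 * l)) * bessel_J0 t ^ 3) \<partial>lborel) = (\<integral>t. \<integral>\<omega>. g \<omega> t \<partial>torus_measure \<partial>lborel)"
  proof (rule Bochner_Integration.integral_cong[OF refl])
    fix t :: real
    show "indicator {0..} t * (t * exp (- t\<^sup>2 / (4 * l)) * bessel_J0 t ^ 3) = (\<integral>\<omega>. g \<omega> t \<partial>torus_measure)"
      using bessel_mean_torus[of t] unfolding g_def by (cases "t \<ge> 0") simp_all
  qed
  also have "\<dots> = (\<integral>\<omega>. \<integral>t. g \<omega> t \<partial>lborel \<partial>torus_measure)"
    by (rule TL.Fubini_integral[OF int])
  also have "\<dots> = (\<integral>\<omega>. 2 * l * exp (- l * squared_modulus \<omega>) \<partial>torus_measure)"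
  proof (rule Bochner_Integration.integral_cong[OF refl])
    fix \<omega>
    show "(\<integral>t. g \<omega> t \<partial>lborel) = 2 * l * exp (- l * squared_modulus \<omega>)"
      using has_bochner_integral_integral_eq[OF bessel_gauss[OF l, of "sqrt (squared_modulus \<omega>)"]] squared_modulus_bounds[of \<omega>]
      by (simp add: g_def)
  qed
  finally show ?thesis by simp
qed

lemma bessel_partial_measurable [measurable]: "bessel_partial R \<in> borel_measurable borel"
  unfolding bessel_partial_def[abs_def] set_lebesgue_integral_def by measurable

text \<open>The value of \<open>Lim\<close> is unspecified without convergence, so the density is
  first seen as a pointwise limit of truncations off \<open>{1, 9}\<close>; changing it at two
  points preserves measurability.\<close>

lemma triangular_density_measurable [measurable]: "triangular_density \<in> borel_measurable borel"
proof -
  define g where "g x = (if x \<le> 0 \<or> x = 1 \<or> x = 9 then 0 else triangular_density x)" for x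
  define s where "s n x = (if x \<le> 0 \<or> x = 1 \<or> x = 9 then 0 else bessel_partial (real n) x / 2)" for n :: nat and x
  have [measurable]: "s n \<in> borel_measurable borel" for n unfolding s_def[abs_def] by measurable
  have "g \<in> borel_measurable borel"
  proof (rule borel_measurable_LIMSEQ_real)
    fix x
    have "(\<lambda>n. bessel_partial (real n) x / 2) \<longlonglongrightarrow> 2 * triangular_density x / 2"
      if "\<not> (x \<le> 0 \<or> x = 1 \<or> x = 9)"
      using that
      by (intro tendsto_intros filterlim_compose[OF bessel_partial_tendsto filterlim_real_sequentially]) auto
    then show "(\<lambda>n. s n x) \<longlonglongrightarrow> g x" by (auto simp: s_def g_def)
  qed measurable
  then show ?thesis
    by (rule measurable_discrete_difference[where X = "{1, 9}"])
       (auto simp: g_def triangular_density_def)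
qed

text \<open>Both sides of \<open>laplace_bessel_partial\<close> are passed to the limit, in
  \<open>x\<close> with the singular majorant and in \<open>t\<close> with the Gaussian one. The
  factors \<open>1 / l\<close>, \<open>2 * l\<close> and the \<open>1 / 2\<close> of the density
  cancel.\<close>

lemma laplace_triangular_density:
  assumes l: "l > 0"
  shows "has_bochner_integral lborel (\<lambda>x. indicator {0<..} x * (exp (- l * x) * triangular_density x))
     (\<integral>\<omega>. exp (- l * squared_modulus \<omega>) \<partial>torus_measure)"
proof -
  obtain K where K: "K \<ge> 0" "\<And>R x. R \<ge> 1 \<Longrightarrow> x > 0 \<Longrightarrow> x \<noteq> 1 \<Longrightarrow> x \<noteq> 9 \<Longrightarrow> \<bar>bessel_partial R x\<bar> \<le> K * (1 + tail_weight (sqrt x))"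
    by (rule bessel_partial_bound) blast
  obtain C where C: "C \<ge> 0" "\<And>t. t \<ge> 0 \<Longrightarrow> \<bar>bessel_J0 t\<bar> \<le> C" using bessel_J0_bounded by blast
  \<comment> \<open>\<open>Suc n\<close> keeps the truncation at least 1, where
    \<open>bessel_partial_bound\<close> applies.\<close>
  define s where "s n x = indicator {0<..} x * (exp (- l * x) * bessel_partial (real (Suc n)) x)" for n x
  define F where "F x = indicator {0<..} x * (exp (- l * x) * (2 * triangular_density x))" for x
  \<comment> \<open>The 11 is \<open>1 + 10\<close>: the term 1 in \<open>1 + tail_weight\<close> is
    absorbed by \<open>P \<ge> 1\<close>, and \<open>tail_weight_bound\<close> contributes
    10.\<close>
  define w where "w x = 11 * K * (indicator {0<..} x * exp (- l * x)
      + indicator {0<..} x * (exp (- l * x) * \<bar>x - 0\<bar> powr (-3/4))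
      + indicator {0<..} x * (exp (- l * x) * \<bar>x - 1\<bar> powr (-3/4))
      + indicator {0<..} x * (exp (- l * x) * \<bar>x - 9\<bar> powr (-3/4)))" for x
  have e: "integrable lborel (\<lambda>x. indicator {0<..} x * exp (- l * x))"
    using integrable_I0i_exp_mscale[OF l] by (simp add: set_integrable_def mult.commute)
  have w: "integrable lborel w"
    unfolding w_def by (intro integrable_mult_right Bochner_Integration.integrable_add e powr_singularity_integrable l)
  have [measurable]: "F \<in> borel_measurable lborel" "s n \<in> borel_measurable lborel" for n
    unfolding F_def[abs_def] s_def[abs_def] by measurable
  have ae: "AE x in lborel. x \<noteq> 1 \<and> x \<noteq> (9::real)"
    using AE_lborel_singleton[of 1] AE_lborel_singleton[of 9] by eventually_elim auto
  have lim: "AE x in lborel. (\<lambda>n. s n x) \<longlonglongrightarrow> F x"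
    using ae
  proof eventually_elim
    fix x :: real assume x: "x \<noteq> 1 \<and> x \<noteq> 9"
    have "(\<lambda>n. bessel_partial (real (Suc n)) x) \<longlonglongrightarrow> 2 * triangular_density x" if "x > 0"
      using filterlim_compose[OF bessel_partial_tendsto filterlim_compose[OF filterlim_real_sequentially filterlim_Suc], of x] x that
      by simp
    then show "(\<lambda>n. s n x) \<longlonglongrightarrow> F x"
      unfolding s_def F_def by (cases "x > 0") (auto intro!: tendsto_intros)
  qed
  have bound: "AE x in lborel. norm (s n x) \<le> w x" for n
    using ae
  proof eventually_elim
    fix x :: real assume x: "x \<noteq> 1 \<and> x \<noteq> 9"
    show "norm (s n x) \<le> w x"
    proof (cases "x > 0")
      case True
      define P where "P = 1 + x powr (-3/4) + \<bar>x - 1\<bar> powr (-3/4) + \<bar>x - 9\<bar> powr (-3/4)"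
      have "\<bar>bessel_partial (real (Suc n)) x\<bar> \<le> K * (1 + tail_weight (sqrt x))"
        using K x True by auto
      also have "\<dots> \<le> K * (P + 10 * P)"
        using K(1) tail_weight_bound[of x] x True
        by (intro mult_left_mono add_mono) (auto simp: P_def)
      finally have "exp (- l * x) * \<bar>bessel_partial (real (Suc n)) x\<bar> \<le> exp (- l * x) * (11 * K * P)"
        by (intro mult_left_mono) (auto simp: algebra_simps)
      then show ?thesis using True by (simp add: s_def w_def P_def abs_mult algebra_simps)
    qed (simp add: s_def w_def)
  qed
  have intF: "integrable lborel F"
    by (rule integrable_dominated_convergence[OF _ _ w lim bound]) measurable
  have lim1: "(\<lambda>n. \<integral>x. s n x \<partial>lborel) \<longlonglongrightarrow> (\<integral>x. F x \<partial>lborel)"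
    by (rule integral_dominated_convergence[OF _ _ w lim bound]) measurable
  define h where "h t = t * exp (- t\<^sup>2 / (4 * l)) * bessel_J0 t ^ 3" for t
  have [measurable]: "h \<in> borel_measurable borel" unfolding h_def[abs_def] by measurable
  have lim2: "(\<lambda>n. \<integral>t. indicator {0..real (Suc n)} t * h t \<partial>lborel) \<longlonglongrightarrow> (\<integral>t. indicator {0..} t * h t \<partial>lborel)"
  proof (rule integral_dominated_convergence)
    show "integrable lborel (\<lambda>t. C ^ 3 * (indicator {0..} t * (t * exp (- t\<^sup>2 / (4 * l)))))"
      using odd_power_gauss_integral[of "1 / (4 * l)" 0] l by (simp add: has_bochner_integral_iff)
    show "AE t in lborel. (\<lambda>n. indicator {0..real (Suc n)} t * h t) \<longlonglongrightarrow> indicator {0..} t * h t"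
    proof (rule AE_I2, rule tendsto_eventually)
      fix t :: real
      have "\<forall>\<^sub>F n in sequentially. t \<le> real n"
        using filterlim_real_sequentially by (auto simp: filterlim_at_top)
      then show "\<forall>\<^sub>F n in sequentially. indicator {0..real (Suc n)} t * h t = indicator {0..} t * h t"
        by eventually_elim (auto simp: indicator_def)
    qed
    show "AE t in lborel. norm (indicator {0..real (Suc n)} t * h t) \<le> C ^ 3 * (indicator {0..} t * (t * exp (- t\<^sup>2 / (4 * l))))" for n
    proof (rule AE_I2)
      fix t :: real
      have "\<bar>bessel_J0 t\<bar> ^ 3 \<le> C ^ 3" if "t \<ge> 0" using C that by (intro power_mono) auto
      then have "t * \<bar>bessel_J0 t\<bar> ^ 3 \<le> t * C ^ 3" if "t \<ge> 0"
        using that by (intro mult_left_mono) auto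
      then show "norm (indicator {0..real (Suc n)} t * h t) \<le> C ^ 3 * (indicator {0..} t * (t * exp (- t\<^sup>2 / (4 * l))))"
        using C(1) by (auto simp: h_def indicator_def abs_mult power_abs mult_ac)
    qed
  qed measurable
  have "(\<integral>x. s n x \<partial>lborel) = (\<integral>t. indicator {0..real (Suc n)} t * h t \<partial>lborel) / l" for n
    unfolding s_def h_def by (rule laplace_bessel_partial[OF l]) simp
  then have "(\<integral>x. F x \<partial>lborel) = (\<integral>t. indicator {0..} t * h t \<partial>lborel) / l"
    using LIMSEQ_unique[OF lim1] tendsto_divide[OF lim2 tendsto_const[of l]] l by simp
  also have "\<dots> = 2 * (\<integral>\<omega>. exp (- l * squared_modulus \<omega>) \<partial>torus_measure)"
    using gauss_bessel_cube[OF l] l unfolding h_def by simp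
  finally have "has_bochner_integral lborel F (2 * (\<integral>\<omega>. exp (- l * squared_modulus \<omega>) \<partial>torus_measure))"
    using intF by (simp add: has_bochner_integral_iff)
  then have "has_bochner_integral lborel (\<lambda>x. 1 / 2 * F x) (1 / 2 * (2 * (\<integral>\<omega>. exp (- l * squared_modulus \<omega>) \<partial>torus_measure)))"
    by (rule has_bochner_integral_mult_right)
  then show ?thesis by (simp add: F_def mult_ac)
qed

subsection \<open>Moments and convergence\<close>

text \<open>Because of \<open>ennreal\<close>, the law of \<open>T\<close> has as density the
  positive part \<open>P\<close>, while the previous lemma concerns \<open>P - Q\<close>. The two
  transforms thus differ by the nonnegative term \<open>q l\<close>, which has to be shown to be
  0.\<close>

lemma laplace_triangular_eigenvalue:
  assumes T: "triangular_eigenvalue N T" and l: "l > 0"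
  shows "(\<integral>\<omega>. exp (- l * T \<omega>) \<partial>N) = (\<integral>\<omega>. exp (- l * squared_modulus \<omega>) \<partial>torus_measure)"
proof -
  interpret N: prob_space N using T by (simp add: triangular_eigenvalue_def)
  interpret V: prob_space torus_measure by (rule prob_space_torus_measure)
  define P where "P x = max 0 (triangular_density x)" for x
  define Q where "Q x = max 0 (- triangular_density x)" for x
  have [measurable]: "P \<in> borel_measurable borel" "Q \<in> borel_measurable borel"
    unfolding P_def[abs_def] Q_def[abs_def] by measurable
  have PQ: "triangular_density x = P x - Q x" "P x \<ge> 0" "Q x \<ge> 0" for x
    by (auto simp: P_def Q_def)
  have D0: "distributed N lborel T (\<lambda>x. ennreal (triangular_density x))"
    using T by (simp add: triangular_eigenvalue_def)
  moreover have "ennreal (triangular_density x) = ennreal (P x)" for x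
    by (simp add: P_def max_def ennreal_neg)
  ultimately have D: "distributed N lborel T (\<lambda>x. ennreal (P x))" by simp
  have [measurable]: "T \<in> borel_measurable N" using D by (simp add: distributed_def)
  have Tpos: "AE \<omega> in N. 0 < T \<omega>"
    by (subst N.distributed_AE2[OF D0]) (auto simp: triangular_density_def)
  define q where "q l = (\<integral>x. exp (- l * x) * Q x \<partial>lborel)" for l
  have split: "integrable lborel (\<lambda>x. exp (- l * x) * Q x)"
      "(\<integral>\<omega>. exp (- l * T \<omega>) \<partial>N) = (\<integral>\<omega>. exp (- l * squared_modulus \<omega>) \<partial>torus_measure) + q l" if "l > 0" for l
  proof -
    have eq: "indicator {0<..} x * (exp (- l * x) * triangular_density x) = exp (- l * x) * triangular_density x" for x
      by (simp add: triangular_density_def)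
    have hbi: "has_bochner_integral lborel (\<lambda>x. exp (- l * x) * triangular_density x)
        (\<integral>\<omega>. exp (- l * squared_modulus \<omega>) \<partial>torus_measure)"
      using laplace_triangular_density[OF that] by (simp only: eq)
    then have int: "integrable lborel (\<lambda>x. exp (- l * x) * triangular_density x)"
      by (simp add: has_bochner_integral_iff)
    show iQ: "integrable lborel (\<lambda>x. exp (- l * x) * Q x)"
      by (rule Bochner_Integration.integrable_bound[OF int]) (auto simp: Q_def abs_mult)
    have "(\<integral>\<omega>. exp (- l * T \<omega>) \<partial>N) = (\<integral>x. P x * exp (- l * x) \<partial>lborel)"
      by (rule distributed_integral[OF D, symmetric]) (auto simp: PQ)
    also have "\<dots> = (\<integral>x. exp (- l * x) * triangular_density x + exp (- l * x) * Q x \<partial>lborel)"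
      by (intro Bochner_Integration.integral_cong refl) (simp add: PQ(1) algebra_simps)
    also have "\<dots> = (\<integral>\<omega>. exp (- l * squared_modulus \<omega>) \<partial>torus_measure) + q l"
      using Bochner_Integration.integral_add[OF int iQ] hbi by (simp add: has_bochner_integral_iff q_def)
    finally show "(\<integral>\<omega>. exp (- l * T \<omega>) \<partial>N) = (\<integral>\<omega>. exp (- l * squared_modulus \<omega>) \<partial>torus_measure) + q l" .
  qed
  \<comment> \<open>Letting the Laplace parameter tend to \<open>0\<close> shows that the negative part of the density vanishes.\<close>
  have q1: "q 1 \<le> 9 * h" if h: "0 < h" "h \<le> 1" for h
  proof -
    have "q 1 \<le> q h" unfolding q_def
    proof (rule integral_mono[OF split(1) split(1)])
      fix x :: real
      show "exp (- 1 * x) * Q x \<le> exp (- h * x) * Q x"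
      proof (cases "x > 0")
        case True
        then show ?thesis using h by (intro mult_right_mono) (auto simp: PQ)
      qed (simp add: Q_def triangular_density_def)
    qed (use h in auto)
    moreover have "(\<integral>\<omega>. exp (- h * T \<omega>) \<partial>N) \<le> 1"
    proof -
      have le: "AE \<omega> in N. exp (- h * T \<omega>) \<le> 1" using Tpos by eventually_elim (use h in simp)
      have "integrable N (\<lambda>\<omega>. exp (- h * T \<omega>))"
        by (rule N.integrable_const_bound[where B = 1]) (use le in auto)
      from integral_mono_AE[OF this N.integrable_const le] show ?thesis by (simp add: N.prob_space)
    qed
    \<comment> \<open>The 9 is the upper bound of \<open>squared_modulus\<close>; as
      \<open>q h\<close> is a difference of two transforms, it is at most
      \<open>1 - (1 - 9 * h)\<close>.\<close>
    moreover have "1 - 9 * h \<le> (\<integral>\<omega>. exp (- h * squared_modulus \<omega>) \<partial>torus_measure)"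
    proof -
      have "1 - 9 * h \<le> exp (- h * squared_modulus \<omega>)" for \<omega>
      proof -
        have "h * squared_modulus \<omega> \<le> h * 9"
          using h by (intro mult_left_mono squared_modulus_bounds) auto
        then show ?thesis using exp_ge_add_one_self[of "- h * squared_modulus \<omega>"] by simp
      qed
      moreover have "integrable torus_measure (\<lambda>\<omega>. exp (- h * squared_modulus \<omega>))"
        by (rule V.integrable_const_bound[where B = 1]) (use h squared_modulus_bounds in auto)
      ultimately have "(\<integral>\<omega>. 1 - 9 * h \<partial>torus_measure) \<le> (\<integral>\<omega>. exp (- h * squared_modulus \<omega>) \<partial>torus_measure)"
        by (intro integral_mono) auto
      then show ?thesis by (simp add: V.prob_space)
    qed
    ultimately show ?thesis using split(2)[OF h(1)] by linarith
  qed
  have "q 1 \<le> 0 + e" if "e > 0" for e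
    using q1[of 1] q1[of "e / 9"] that by (cases "e \<ge> 9") auto
  then have "q 1 \<le> 0" by (rule field_le_epsilon)
  moreover have "q 1 \<ge> 0" unfolding q_def by (intro integral_nonneg_AE AE_I2) (simp add: PQ)
  ultimately have "q 1 = 0" by simp
  \<comment> \<open>A nonnegative integrand with integral 0 vanishes almost everywhere. So
    \<open>Q\<close> does, and \<open>q l = 0\<close> follows for every \<open>l\<close>, not only
    for \<open>l = 1\<close>.\<close>
  then have "AE x in lborel. exp (- 1 * x) * Q x = 0"
    unfolding q_def by (subst (asm) integral_nonneg_eq_0_iff_AE) (use split(1)[of 1] in \<open>auto simp: PQ\<close>)
  then have "q l = (\<integral>x. 0 \<partial>(lborel :: real measure))"
    unfolding q_def by (intro integral_cong_AE) (auto elim!: eventually_mono)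
  then show ?thesis using split(2)[OF l] by simp
qed

section \<open>From Laplace transforms to moments\<close>

lemma compactly_supported_bounded:
  assumes "compactly_supported M X"
  shows "\<exists>B\<ge>0. AE \<omega> in M. \<bar>X \<omega>\<bar> \<le> B"
proof -
  obtain K where K: "compact K" "AE \<omega> in M. X \<omega> \<in> K"
    using assms unfolding compactly_supported_def by blast
  obtain B where B: "\<And>x. x \<in> K \<Longrightarrow> \<bar>x\<bar> \<le> B"
    using compact_imp_bounded[OF K(1)] unfolding bounded_iff real_norm_def by blast
  have "AE \<omega> in M. \<bar>X \<omega>\<bar> \<le> max 0 B" using K(2) by eventually_elim (use B in fastforce)
  then show ?thesis by (intro exI[of _ "max 0 B"]) auto
qed

lemma (in prob_space) integrable_power_bounded:
  fixes X :: "'a \<Rightarrow> real"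
  assumes "X \<in> borel_measurable M" "AE \<omega> in M. \<bar>X \<omega>\<bar> \<le> B"
  shows "integrable M (\<lambda>\<omega>. X \<omega> ^ k)"
proof (rule integrable_const_bound[where B = "B ^ k"])
  show "AE \<omega> in M. norm (X \<omega> ^ k) \<le> B ^ k"
    using assms(2) by eventually_elim (auto simp: power_abs intro: power_mono)
qed (use assms(1) in measurable)

text \<open>For bounded \<open>X\<close> the exponential series may be integrated termwise, with
  majorant \<open>|l * B| ^ k / fact k\<close>. The moments thereby become coefficients of an entire
  function of \<open>l\<close>.\<close>

lemma (in prob_space) laplace_moment_series:
  fixes X :: "'a \<Rightarrow> real"
  assumes [measurable]: "X \<in> borel_measurable M" and B: "AE \<omega> in M. \<bar>X \<omega>\<bar> \<le> B" "B \<ge> 0"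
  shows "(\<lambda>k. (expectation (\<lambda>\<omega>. X \<omega> ^ k) * (-1) ^ k / fact k) * l ^ k) sums expectation (\<lambda>\<omega>. exp (- l * X \<omega>))"
proof -
  define f where "f k \<omega> = (- l * X \<omega>) ^ k / fact k" for k \<omega>
  have f: "f k \<omega> = ((- l) ^ k / fact k) * X \<omega> ^ k" for k \<omega> by (simp only: f_def power_mult_distrib) simp
  have int: "integrable M (f k)" for k
    unfolding f[abs_def] by (intro integrable_mult_right integrable_power_bounded[OF _ B(1)]) measurable
  have bnd: "AE \<omega> in M. \<forall>k. norm (f k \<omega>) \<le> \<bar>l * B\<bar> ^ k / fact k"
    using B(1)
  proof eventually_elim
    fix \<omega> assume "\<bar>X \<omega>\<bar> \<le> B"
    then have "\<bar>- l * X \<omega>\<bar> \<le> \<bar>l * B\<bar>" using B(2) by (simp add: abs_mult mult_left_mono)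
    then show "\<forall>k. norm (f k \<omega>) \<le> \<bar>l * B\<bar> ^ k / fact k"
      by (auto simp: f_def power_abs abs_divide intro!: divide_right_mono power_mono simp del: abs_mult)
  qed
  have s1: "AE \<omega> in M. summable (\<lambda>k. norm (f k \<omega>))"
    using bnd by eventually_elim (auto intro!: summable_comparison_test'[OF exp_series_summable])
  have s2: "summable (\<lambda>k. \<integral>\<omega>. norm (f k \<omega>) \<partial>M)"
  proof (rule summable_comparison_test'[OF exp_series_summable])
    fix k
    have "(\<integral>\<omega>. norm (f k \<omega>) \<partial>M) \<le> (\<integral>\<omega>. \<bar>l * B\<bar> ^ k / fact k \<partial>M)"
      by (intro integral_mono_AE integrable_norm int integrable_const) (use bnd in \<open>auto elim: eventually_mono\<close>)
    then show "norm (\<integral>\<omega>. norm (f k \<omega>) \<partial>M) \<le> \<bar>l * B\<bar> ^ k / fact k" by (simp add: prob_space)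
  qed
  have "(\<lambda>k. \<integral>\<omega>. f k \<omega> \<partial>M) sums (\<integral>\<omega>. (\<Sum>k. f k \<omega>) \<partial>M)" by (rule sums_integral[OF int s1 s2])
  moreover have "(\<Sum>k. f k \<omega>) = exp (- l * X \<omega>)" for \<omega>
    unfolding f_def by (rule sums_unique[OF exp_sums_real, symmetric])
  moreover have "(\<integral>\<omega>. f k \<omega> \<partial>M) = (expectation (\<lambda>\<omega>. X \<omega> ^ k) * (-1) ^ k / fact k) * l ^ k" for k
    unfolding f by (simp add: power_minus[of l])
  ultimately show ?thesis by simp
qed

lemma power_series_zero_right_head:
  fixes a :: "nat \<Rightarrow> real"
  assumes "\<And>x. summable (\<lambda>n. a n * x ^ n)" and "\<And>x. x > 0 \<Longrightarrow> (\<Sum>n. a n * x ^ n) = 0"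
  shows "a 0 = 0"
proof -
  have "((\<lambda>x. \<Sum>n. a n * x ^ n) \<longlongrightarrow> a 0) (at 0)"
    by (rule powser_limit_0[of 1]) (auto intro: summable_sums assms(1))
  then have "((\<lambda>x. \<Sum>n. a n * x ^ n) \<longlongrightarrow> a 0) (at_right 0)"
    by (rule tendsto_mono[rotated]) (simp add: at_within_le_at)
  moreover have "\<forall>\<^sub>F x in at_right 0. (\<Sum>n. a n * x ^ n) = 0"
    using assms(2) by (auto simp: eventually_at_filter)
  ultimately have "((\<lambda>x. 0) \<longlongrightarrow> a 0) (at_right (0::real))"
    by (rule Lim_transform_eventually)
  then show ?thesis using tendsto_const_iff[of "at_right (0::real)" 0 "a 0"] by simp
qed

text \<open>Vanishing is known only to the right of 0, where the Laplace transforms agree. The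
  constant term is the right-hand limit at 0, and dividing the series by \<open>x\<close> moves the
  next coefficient into its place.\<close>

lemma power_series_zero_right:
  fixes a :: "nat \<Rightarrow> real"
  assumes "\<And>x. summable (\<lambda>n. a n * x ^ n)" and "\<And>x. x > 0 \<Longrightarrow> (\<Sum>n. a n * x ^ n) = 0"
  shows "a n = 0"
  using assms
proof (induction n arbitrary: a)
  case 0
  then show ?case by (rule power_series_zero_right_head)
next
  case (Suc n)
  have a0: "a 0 = 0" using Suc.prems by (rule power_series_zero_right_head)
  have s: "summable (\<lambda>n. a (Suc n) * x ^ n)" for x
  proof (cases "x = 0")
    case False
    have "summable (\<lambda>n. a (Suc n) * x ^ Suc n / x)"
      using Suc.prems(1)[of x] by (intro summable_divide) (subst summable_Suc_iff[of "\<lambda>n. a n * x ^ n"])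
    then show ?thesis using False by simp
  qed (auto intro: summable_0_powser)
  show ?case
  proof (rule Suc.IH[OF s])
    fix x :: real assume x: "x > 0"
    have "x * (\<Sum>n. a (Suc n) * x ^ n) = (\<Sum>n. a (Suc n) * x ^ Suc n)"
      by (subst suminf_mult[OF s, symmetric]) (simp add: mult_ac)
    also have "\<dots> = 0"
      using suminf_split_head[OF Suc.prems(1)[of x]] Suc.prems(2)[OF x] a0 by simp
    finally show "(\<Sum>n. a (Suc n) * x ^ n) = 0" using x by simp
  qed
qed

lemma triangular_eigenvalue_moments:
  assumes T: "triangular_eigenvalue N T"
  shows "(\<integral>\<omega>. T \<omega> ^ k \<partial>N) = (\<integral>\<omega>. squared_modulus \<omega> ^ k \<partial>torus_measure)"
proof -
  interpret N: prob_space N using T by (simp add: triangular_eigenvalue_def)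
  interpret V: prob_space torus_measure by (rule prob_space_torus_measure)
  have Tm: "T \<in> borel_measurable N"
    using T by (simp add: triangular_eigenvalue_def distributed_def)
  obtain B where B: "B \<ge> 0" "AE \<omega> in N. \<bar>T \<omega>\<bar> \<le> B"
    using compactly_supported_bounded T unfolding triangular_eigenvalue_def by blast
  have Vb: "AE \<omega> in torus_measure. \<bar>squared_modulus \<omega>\<bar> \<le> 9" using squared_modulus_bounds by auto
  have Vm: "squared_modulus \<in> borel_measurable torus_measure" by measurable
  define a where "a k = (\<integral>\<omega>. T \<omega> ^ k \<partial>N) * (-1) ^ k / fact k
      - (\<integral>\<omega>. squared_modulus \<omega> ^ k \<partial>torus_measure) * (-1) ^ k / fact k" for k
  have s: "(\<lambda>k. a k * l ^ k) sums ((\<integral>\<omega>. exp (- l * T \<omega>) \<partial>N) - (\<integral>\<omega>. exp (- l * squared_modulus \<omega>) \<partial>torus_measure))" for l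
    using sums_diff[OF N.laplace_moment_series[OF Tm B(2,1), of l] V.laplace_moment_series[OF Vm Vb, of l]]
    by (simp add: a_def left_diff_distrib)
  have "a k = 0"
  proof (rule power_series_zero_right)
    show "summable (\<lambda>n. a n * x ^ n)" for x using s by (rule sums_summable)
    show "(\<Sum>n. a n * x ^ n) = 0" if "x > 0" for x
      using sums_unique[OF s[of x]] laplace_triangular_eigenvalue[OF T that] by simp
  qed
  then show ?thesis by (simp add: a_def)
qed

section \<open>From moments to characteristic functions\<close>

text \<open>Both characteristic functions have the same Taylor polynomial \<open>S\<close>, and each
  remainder is at most \<open>2 * |t| ^ K / fact K\<close> times the absolute moment of order
  \<open>K\<close>. For even \<open>K\<close> this is the common moment itself, so the bound is
  expressed by \<open>Y\<close> alone and is uniform in the law of \<open>X\<close>.\<close>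

lemma char_distr_diff_bound:
  fixes X :: "'a \<Rightarrow> real" and Y :: "'b \<Rightarrow> real"
  assumes "prob_space M" "X \<in> borel_measurable M" "AE \<omega> in M. \<bar>X \<omega>\<bar> \<le> B"
    and "prob_space N" "Y \<in> borel_measurable N" "AE \<omega> in N. \<bar>Y \<omega>\<bar> \<le> B'"
    and eq: "\<And>k. k \<le> K \<Longrightarrow> (\<integral>\<omega>. X \<omega> ^ k \<partial>M) = (\<integral>\<omega>. Y \<omega> ^ k \<partial>N)" and "even K"
  shows "dist (char (distr M borel X) t) (char (distr N borel Y) t) \<le> 4 * (\<bar>t\<bar> ^ K / fact K) * (\<integral>\<omega>. Y \<omega> ^ K \<partial>N)"
proof -
  interpret M: prob_space M by fact
  interpret N: prob_space N by fact
  define S where "S = (\<Sum>k\<le>K. ((\<i> * t) ^ k / fact k) * complex_of_real (\<integral>\<omega>. Y \<omega> ^ k \<partial>N))"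
  have "cmod (char (distr M borel X) t - (\<Sum>k\<le>K. ((\<i> * t) ^ k / fact k) * complex_of_real (\<integral>\<omega>. X \<omega> ^ k \<partial>M)))
      \<le> (2 * \<bar>t\<bar> ^ K / fact K) * (\<integral>\<omega>. \<bar>X \<omega>\<bar> ^ K \<partial>M)"
    by (rule M.char_approx1'[OF M.integrable_power_bounded[OF assms(2,3)] assms(2) refl])
  moreover have "(\<Sum>k\<le>K. ((\<i> * t) ^ k / fact k) * complex_of_real (\<integral>\<omega>. X \<omega> ^ k \<partial>M)) = S"
    unfolding S_def by (intro sum.cong) (auto simp: eq)
  moreover have "cmod (char (distr N borel Y) t - S) \<le> (2 * \<bar>t\<bar> ^ K / fact K) * (\<integral>\<omega>. \<bar>Y \<omega>\<bar> ^ K \<partial>N)"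
    unfolding S_def by (rule N.char_approx1'[OF N.integrable_power_bounded[OF assms(5,6)] assms(5) refl])
  ultimately have "cmod (char (distr M borel X) t - S) + cmod (char (distr N borel Y) t - S)
      \<le> (2 * \<bar>t\<bar> ^ K / fact K) * (\<integral>\<omega>. Y \<omega> ^ K \<partial>N) + (2 * \<bar>t\<bar> ^ K / fact K) * (\<integral>\<omega>. Y \<omega> ^ K \<partial>N)"
    using \<open>even K\<close> eq[of K] by (simp add: power_even_abs)
  then show ?thesis
    using dist_triangle2[of "char (distr M borel X) t" "char (distr N borel Y) t" S]
    by (simp add: dist_norm)
qed

text \<open>For fixed \<open>t\<close> the order \<open>K\<close> is chosen from the limit law
  alone. As soon as \<open>p n + q n\<close> exceeds \<open>K\<close>, all moments up to order
  \<open>K\<close> agree exactly, so only the Taylor remainders are left.\<close>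

theorem proposition1:
  fixes c :: real
    and p q :: "nat \<Rightarrow> nat"
    and M :: "nat \<Rightarrow> nat \<Rightarrow> 'a measure"
    and \<Lambda> :: "nat \<Rightarrow> nat \<Rightarrow> 'a \<Rightarrow> real"
    and N :: "'b measure"
    and T :: "'b \<Rightarrow> real"
  assumes "c \<in> {0..1}"
    and "\<And>a b. (a, b) \<in> nanotube_indices \<Longrightarrow> nanotube_eigenvalue a b (M a b) (\<Lambda> a b)"
    and "triangular_eigenvalue N T"
    and "\<And>n. (p n, q n) \<in> nanotube_indices"
    and "filterlim (\<lambda>n. p n + q n) at_top sequentially"
    and "(\<lambda>n. real (p n) / real (p n + q n)) \<longlonglongrightarrow> c"
  shows "weak_conv_m (\<lambda>n. distr (M (p n) (q n)) borel (\<Lambda> (p n) (q n))) (distr N borel T)"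
proof (rule levy_continuity)
  have \<Lambda>: "prob_space (M (p n) (q n))" "\<Lambda> (p n) (q n) \<in> borel_measurable (M (p n) (q n))"
      "compactly_supported (M (p n) (q n)) (\<Lambda> (p n) (q n))"
      "\<And>k. complex_of_real (\<integral>\<omega>. \<Lambda> (p n) (q n) \<omega> ^ k \<partial>M (p n) (q n)) = nanotube_moment (p n) (q n) k" for n
    using assms(2)[OF assms(4)[of n]] by (auto simp: nanotube_eigenvalue_def)
  have T: "prob_space N" "T \<in> borel_measurable N" "compactly_supported N T"
    using assms(3) by (auto simp: triangular_eigenvalue_def distributed_def)
  show "real_distribution (distr (M (p n) (q n)) borel (\<Lambda> (p n) (q n)))" for n
    by (rule prob_space.real_distribution_distr[OF \<Lambda>(1,2)])
  show "real_distribution (distr N borel T)"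
    by (rule prob_space.real_distribution_distr[OF T(1,2)])
  obtain B where B: "AE \<omega> in N. \<bar>T \<omega>\<bar> \<le> B" using compactly_supported_bounded[OF T(3)] by blast
  interpret V: prob_space torus_measure by (rule prob_space_torus_measure)
  show "(\<lambda>n. char (distr (M (p n) (q n)) borel (\<Lambda> (p n) (q n))) t) \<longlonglongrightarrow> char (distr N borel T) t" for t
  proof (rule tendstoI)
    fix \<epsilon> :: real assume "\<epsilon> > 0"
    have "(\<lambda>k. 4 * (\<bar>9 * t\<bar> ^ k / fact k)) \<longlonglongrightarrow> 4 * 0"
      by (intro tendsto_mult tendsto_const summable_LIMSEQ_zero exp_series_summable)
    then have "\<forall>\<^sub>F k in sequentially. 4 * (\<bar>9 * t\<bar> ^ k / fact k) < \<epsilon>"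
      using \<open>\<epsilon> > 0\<close> by (intro order_tendstoD) auto
    then obtain K0 where K0: "\<And>k. k \<ge> K0 \<Longrightarrow> 4 * (\<bar>9 * t\<bar> ^ k / fact k) < \<epsilon>"
      unfolding eventually_sequentially by blast
    \<comment> \<open>Doubling makes \<open>K\<close> even, as \<open>char_distr_diff_bound\<close>
      demands, and keeps it at least \<open>K0\<close>.\<close>
    define K where "K = 2 * K0"
    have "(\<integral>\<omega>. T \<omega> ^ K \<partial>N) = (\<integral>\<omega>. squared_modulus \<omega> ^ K \<partial>torus_measure)"
      by (rule triangular_eigenvalue_moments[OF assms(3)])
    also have "\<dots> \<le> (\<integral>\<omega>. 9 ^ K \<partial>torus_measure)"
      by (intro integral_mono V.integrable_power_bounded[where B = 9] V.integrable_const power_mono)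
         (use squared_modulus_bounds in auto)
    also have "\<dots> = 9 ^ K" by (simp add: V.prob_space)
    finally have "4 * (\<bar>t\<bar> ^ K / fact K) * (\<integral>\<omega>. T \<omega> ^ K \<partial>N) \<le> 4 * (\<bar>t\<bar> ^ K / fact K) * 9 ^ K"
      by (intro mult_left_mono) auto
    also have "\<dots> = 4 * (\<bar>9 * t\<bar> ^ K / fact K)" by (simp add: abs_mult power_mult_distrib)
    also have "\<dots> < \<epsilon>" using K0[of K] by (simp add: K_def)
    finally have small: "4 * (\<bar>t\<bar> ^ K / fact K) * (\<integral>\<omega>. T \<omega> ^ K \<partial>N) < \<epsilon>" .
    have "\<forall>\<^sub>F n in sequentially. K < p n + q n"
      by (rule eventually_compose_filterlim[OF eventually_gt_at_top assms(5)])
    then show "\<forall>\<^sub>F n in sequentially. dist (char (distr (M (p n) (q n)) borel (\<Lambda> (p n) (q n))) t) (char (distr N borel T) t) < \<epsilon>"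
    proof eventually_elim
      fix n assume n: "K < p n + q n"
      obtain B' where B': "AE \<omega> in M (p n) (q n). \<bar>\<Lambda> (p n) (q n) \<omega>\<bar> \<le> B'"
        using compactly_supported_bounded[OF \<Lambda>(3)] by blast
      have "(\<integral>\<omega>. \<Lambda> (p n) (q n) \<omega> ^ k \<partial>M (p n) (q n)) = (\<integral>\<omega>. T \<omega> ^ k \<partial>N)" if "k \<le> K" for k
      proof -
        have "k < p n + q n" using that n by simp
        from nanotube_moment_eq_torus[OF this] \<Lambda>(4)[of n k] show ?thesis
          by (simp add: triangular_eigenvalue_moments[OF assms(3)])
      qed
      then have "dist (char (distr (M (p n) (q n)) borel (\<Lambda> (p n) (q n))) t) (char (distr N borel T) t)
          \<le> 4 * (\<bar>t\<bar> ^ K / fact K) * (\<integral>\<omega>. T \<omega> ^ K \<partial>N)"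
        by (intro char_distr_diff_bound[OF \<Lambda>(1,2) B' T(1,2) B]) (auto simp: K_def)
      then show "dist (char (distr (M (p n) (q n)) borel (\<Lambda> (p n) (q n))) t) (char (distr N borel T) t) < \<epsilon>"
        using small by linarith
    qed
  qed
qed

end
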